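(* Assume the flow $\varphi_{0t}^v(\mathbf{x}_0)$ hits the time-varying switching boundary $\Sigma(t)$ at the point $\mathbf{x}_1$ in time $t_1$ and then crosses it transversally, and let $n(t_1,\mathbf{x}_1)$ be the unit normal to $\Sigma(t_1)$ at $\mathbf{x}_1$. Then the saltation matrix has the form $$S = I + \frac{\big(v^+(t_1,\mathbf{x}_1) - v^-(t_1,\mathbf{x}_1)\big)\,n^T(t_1,\mathbf{x}_1)}{n^T(t_1,\mathbf{x}_1)\, v^-(t_1,\mathbf{x}_1)+\frac{\partial H(t_1,\mathbf{x}_1)}{\partial t}}.$$
   Context: Let $\Omega\subset\mathbb{R}^d$ ($d\in\{2,3\}$) and consider the differential system $\frac{\partial \varphi(t,\mathbf{x})}{\partial t}=v(t,\varphi(t,\mathbf{x}))$, $\varphi(0,\mathbf{x})=\mathbf{x}$ for all $\mathbf{x}\in\Omega$. Its right-hand side $v$ may be discontinuous across hypersurfaces. (In the motivating setting, $v$ is a velocity field generated by zeroth- and first-order momenta through a non-differentiable kernel and its first partial derivatives; nonzero first-order momenta determine the location of the discontinuity hypersurfaces, which are assumed to be finite in number.) $\varphi_{0t}^v(\mathbf{x}_0)$ is the position at time $t$ of the trajectory that starts at $\mathbf{x}_0$ at time $0$. Switching boundary: $\Sigma(t)$ is a hypersurface, varying with time $t$, at which the velocity field switches (is discontinuous). It is represented as the zero level set of a function $H(t)=H(t,\cdot)$ on $\Omega$ with real values: $\mathbf{x}=\varphi_{0t}^v(\mathbf{x}_0)\in\Sigma(t)$ if and only if $H(t,\mathbf{x})=0$.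 A trajectory that hits a switching boundary can exhibit two distinct behaviors: crossing the boundary transversally or sliding along it; the case considered here is transversal crossing. $v^-$ and $v^+$ denote the velocities of the flow $\varphi_{0t}^v(\mathbf{x}_0)$ before and after hitting the switching boundary. Fundamental solution matrix: $D\varphi_{0t}^v(\mathbf{x}_0)$ is the first-order expansion of the flow of perturbations around the reference trajectory, i.e. for an infinitesimal perturbation $\mathbf{y}_0$ of $\mathbf{x}_0$, $\varphi_{0t}^v(\mathbf{y}_0)-\varphi_{0t}^v(\mathbf{x}_0)=D\varphi_{0t}^v(\mathbf{x}_0)(\mathbf{y}_0-\mathbf{x}_0)+O(\|\mathbf{y}_0-\mathbf{x}_0\|^2)$. Saltation (jump) matrix: the matrix $S$ describing the jump of the fundamental solution matrix at the hitting time $t_1$, i.e. $D\varphi_{0t_1^+}^v(\mathbf{x}_0)=S\,D\varphi_{0t_1^-}^v(\mathbf{x}_0)$, where $D\varphi_{0t_1^\pm}^v(\mathbf{x}_0)=\lim_{t\to t_1^\pm}D\varphi_{0t}^v(\mathbf{x}_0)$. It can also be regarded as the fundamental solution matrix from time $t_1^-$ to $t_1^+$, $S=D\varphi_{t_1^-t_1^+}^v(\mathbf{x}_1)$. $I$ is the identity matrix.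
   Formalization: Where ∂H/∂t ≠ 0, H is scaled so that ∇H = n at (t1,x1), as the formula fails otherwise; H is C¹, v^± are continuous and Lipschitz in x up to Σ, v on Σ lies between v^- and v^+; S is claimed unique only if D at t1^- is invertible. *)

theory Defs
  imports "HOL-Analysis.Analysis" "HOL-Library.Landau_Symbols"
begin

text \<open>
  Time-dependent vector fields, level-set functions and flows are curried, with time as the
  first argument: \<open>v t x\<close>, \<open>H t x\<close>, and \<open>\<phi> t x\<close> for the position at time \<open>t\<close> of the trajectory
  that starts at \<open>x\<close> at time \<open>0\<close>.
\<close>

text \<open>
  The field may jump, so trajectories are not differentiable at switching times; the differential
  system is therefore read in integrated form (which also forces continuity in time).
\<close>

definition trajectory ::
    "(real \<Rightarrow> 'a \<Rightarrow> 'a) \<Rightarrow> 'a set \<Rightarrow> real \<Rightarrow> 'a::euclidean_space \<Rightarrow> (real \<Rightarrow> 'a) \<Rightarrow> bool" where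
  "trajectory v \<Omega> T x u \<longleftrightarrow>
     u 0 = x \<and>
     (\<forall>t\<in>{0..T}. u t \<in> \<Omega> \<and> ((\<lambda>s. v s (u s)) has_integral (u t - x)) {0..t})"

definition switching_boundary :: "'a set \<Rightarrow> (real \<Rightarrow> 'a \<Rightarrow> real) \<Rightarrow> real \<Rightarrow> 'a set" where
  "switching_boundary \<Omega> H t = {x \<in> \<Omega>. H t x = 0}"

definition C1_on :: "('a::real_normed_vector \<Rightarrow> real) \<Rightarrow> 'a set \<Rightarrow> bool" where
  "C1_on f N \<longleftrightarrow>
     (\<exists>f' :: 'a \<Rightarrow> 'a \<Rightarrow>\<^sub>L real.
        (\<forall>p\<in>N. (f has_derivative blinfun_apply (f' p)) (at p)) \<and> continuous_on N f')"

text \<open>Unit vectors spanning the normal line of a level set; both orientations qualify.\<close>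

definition unit_normal :: "(real \<Rightarrow> 'a \<Rightarrow> real) \<Rightarrow> real \<Rightarrow> 'a::real_inner \<Rightarrow> 'a \<Rightarrow> bool" where
  "unit_normal H t x n \<longleftrightarrow> norm n = 1 \<and> (\<exists>c. c \<noteq> 0 \<and> (GDERIV (H t) x :> c *\<^sub>R n))"

definition regular_field ::
    "(real \<times> 'a) set \<Rightarrow> (real \<Rightarrow> 'a \<Rightarrow> 'a::euclidean_space) \<Rightarrow> bool" where
  "regular_field R f \<longleftrightarrow>
     continuous_on R (\<lambda>(t, x). f t x) \<and> (\<exists>L. \<forall>t. L-lipschitz_on {x. (t, x) \<in> R} (f t))"

text \<open>
  Near the hitting point, \<open>v\<close> agrees with \<open>vm\<close> on the side \<open>\<sigma> * H < 0\<close> and with \<open>vp\<close> on the side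
  \<open>\<sigma> * H > 0\<close>, each being regular up to the boundary. The sign \<open>\<sigma>\<close> only records in which
  direction the boundary is crossed. On the boundary itself \<open>v\<close> may take any value allowed by the
  Filippov convention, i.e. in the segment between the two one-sided values; some such restriction
  is needed, since otherwise a tangential value of \<open>v\<close> there would permit sliding.
\<close>

definition switching_field ::
    "(real \<times> 'a) set \<Rightarrow> real \<Rightarrow> (real \<Rightarrow> 'a \<Rightarrow> real) \<Rightarrow> (real \<Rightarrow> 'a \<Rightarrow> 'a::euclidean_space)
      \<Rightarrow> (real \<Rightarrow> 'a \<Rightarrow> 'a) \<Rightarrow> (real \<Rightarrow> 'a \<Rightarrow> 'a) \<Rightarrow> bool" where
  "switching_field N \<sigma> H v vm vp \<longleftrightarrow>
     regular_field {(t, x) \<in> N. \<sigma> * H t x \<le> 0} vm \<and>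
     regular_field {(t, x) \<in> N. \<sigma> * H t x \<ge> 0} vp \<and>
     (\<forall>(t, x)\<in>N. (\<sigma> * H t x < 0 \<longrightarrow> v t x = vm t x) \<and>
                 (\<sigma> * H t x > 0 \<longrightarrow> v t x = vp t x) \<and>
                 (H t x = 0 \<longrightarrow> v t x \<in> closed_segment (vm t x) (vp t x)))"

text \<open>
  The curve \<open>u\<close> passes from one side of the moving boundary to the other at time \<open>t1\<close>, and neither
  one-sided velocity is tangent to the boundary in space-time: the velocities relative to the
  moving boundary have nonzero normal components.
\<close>

definition crosses_transversally ::
    "real \<Rightarrow> (real \<Rightarrow> 'a \<Rightarrow> real) \<Rightarrow> (real \<Rightarrow> 'a) \<Rightarrow> real \<Rightarrow> 'a::euclidean_space \<Rightarrow> 'a \<Rightarrow> 'a \<Rightarrow> bool"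
  where
  "crosses_transversally \<sigma> H u t1 n wm wp \<longleftrightarrow>
     (\<forall>\<^sub>F t in at_left t1. \<sigma> * H t (u t) < 0) \<and>
     (\<forall>\<^sub>F t in at_right t1. \<sigma> * H t (u t) > 0) \<and>
     n \<bullet> wm + deriv (\<lambda>t. H t (u t1)) t1 \<noteq> 0 \<and>
     n \<bullet> wp + deriv (\<lambda>t. H t (u t1)) t1 \<noteq> 0"

definition fundamental_matrix ::
    "(real \<Rightarrow> real ^ 'd \<Rightarrow> real ^ 'd) \<Rightarrow> real \<Rightarrow> real ^ 'd \<Rightarrow> real ^ 'd ^ 'd \<Rightarrow> bool" where
  "fundamental_matrix \<phi> t x D \<longleftrightarrow>
     (\<lambda>y. norm (\<phi> t y - \<phi> t x - D *v (y - x))) \<in> O[nhds x](\<lambda>y. (norm (y - x))\<^sup>2)"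

definition saltation_matrix ::
    "(real \<Rightarrow> real ^ 'd ^ 'd) \<Rightarrow> real \<Rightarrow> real ^ 'd ^ 'd \<Rightarrow> bool" where
  "saltation_matrix D t1 S \<longleftrightarrow>
     (\<exists>Dm Dp. (D \<longlongrightarrow> Dm) (at_left t1) \<and> (D \<longlongrightarrow> Dp) (at_right t1) \<and> Dp = S ** Dm)"

end

theory Submission
  imports Defs
begin

text \<open>
  Choose times \<open>s < t1 < t\<close> close to the hitting time and compare the reference trajectory \<open>u\<close> with a
  perturbed one \<open>w\<close>. Both cross the boundary exactly once between \<open>s\<close> and \<open>t\<close>, at times \<open>a\<close> and \<open>b\<close>.
  As long as both are on the same side, they follow the same Lipschitz field, and over a short time their
  difference hardly changes relative to its size. Between \<open>a\<close> and \<open>b\<close> one curve moves with velocity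
  about \<open>v\<^sup>+\<close> and the other with about \<open>v\<^sup>-\<close>, so the difference jumps by \<open>(b - a) (v\<^sup>- - v\<^sup>+)\<close>. The delay
  \<open>b - a\<close> follows from linearising \<open>H = 0\<close> at the two crossing points: it is
  \<open>- (\<nabla>H \<bullet> d) / (\<partial>H/\<partial>t + \<nabla>H \<bullet> v\<^sup>-)\<close> for \<open>d = w a - u a\<close>. Together this is the matrix \<open>S\<close>, applied to \<open>d\<close>
  (lemmas \<open>crossing_jump\<close> and \<open>crossings_estimate\<close>).

  Transversality enters through the level function. The signs of \<open>H\<close> along the reference trajectory and
  the nonvanishing of the rates \<open>\<partial>H/\<partial>t + \<nabla>H \<bullet> v\<^sup>\<plusminus>\<close> force both rates to be positive, up to the orientation
  \<open>\<sigma>\<close> (\<open>rates_nonneg\<close>). By the Filippov condition, every velocity occurring near the hitting point is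
  nearly a convex combination of \<open>v\<^sup>-\<close> and \<open>v\<^sup>+\<close>, so \<open>H\<close> grows at a definite rate along every trajectory there
  (\<open>level_growth\<close>); this gives the single crossing and bounds the delay by a multiple of the distance.

  All errors are at most \<open>\<kappa>\<close> times the size of \<open>w s - u s\<close>, where \<open>\<kappa>\<close> becomes arbitrarily small as \<open>s\<close> and
  \<open>t\<close> approach \<open>t1\<close>. For fixed \<open>s\<close> and \<open>t\<close>, letting the perturbation tend to zero turns the estimate into
  one for the fundamental matrices \<open>D s\<close> and \<open>D t\<close>
  (\<open>curve_deviation_imp_fundamental_matrix_bound\<close>). Before the hitting time the analogous estimate shows
  that \<open>D\<close> is Lipschitz, so the left-hand limit exists, and the right-hand limit is \<open>S\<close> times it
  (\<open>saltation_limits\<close>).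
\<close>

section \<open>Integral curves\<close>

text \<open>
  Restarting a trajectory at an intermediate time is the basic operation below, so the integral
  equation is required between any two times of \<open>J\<close>.
\<close>

definition integral_curve_on ::
    "(real \<Rightarrow> 'a \<Rightarrow> 'a::euclidean_space) \<Rightarrow> real set \<Rightarrow> (real \<Rightarrow> 'a) \<Rightarrow> bool" where
  "integral_curve_on v J u \<longleftrightarrow>
     (\<forall>a\<in>J. \<forall>b\<in>J. a \<le> b \<longrightarrow> ((\<lambda>q. v q (u q)) has_integral (u b - u a)) {a..b})"

lemma integral_curve_onD:
  assumes "integral_curve_on v J u" "a \<in> J" "b \<in> J" "a \<le> b"
  shows "((\<lambda>q. v q (u q)) has_integral (u b - u a)) {a..b}"
  using assms unfolding integral_curve_on_def by blast

lemma integral_curve_on_subset: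
  "integral_curve_on v J u \<Longrightarrow> I \<subseteq> J \<Longrightarrow> integral_curve_on v I u"
  unfolding integral_curve_on_def by blast

lemma trajectory_imp_integral_curve_on:
  assumes "trajectory v \<Omega> T x u"
  shows "integral_curve_on v {0..T} u"
  unfolding integral_curve_on_def
proof (intro ballI impI)
  fix a b assume ab: "a \<in> {0..T}" "b \<in> {0..T}" "a \<le> b"
  let ?f = "\<lambda>q. v q (u q)"
  have I: "(?f has_integral (u t - x)) {0..t}" if "t \<in> {0..T}" for t
    using assms that unfolding trajectory_def by blast
  have "?f integrable_on {0..b}" using I[OF ab(2)] by blast
  then have f: "?f integrable_on {a..b}"
    by (rule integrable_subinterval_real) (use ab in auto)
  have "(?f has_integral ((u a - x) + integral {a..b} ?f)) {0..b}"
    using ab I[OF ab(1)] integrable_integral[OF f] by (intro has_integral_combine[of 0 a b]) auto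
  with I[OF ab(2)] have "u b - x = (u a - x) + integral {a..b} ?f"
    by (rule has_integral_unique)
  then have "integral {a..b} ?f = u b - u a" by (simp add: algebra_simps)
  with integrable_integral[OF f] show "(?f has_integral (u b - u a)) {a..b}" by simp
qed

lemma integral_curve_on_continuous:
  assumes "integral_curve_on v {s..t} u"
  shows "continuous_on {s..t} u"
proof (cases "s \<le> t")
  case True
  let ?f = "\<lambda>q. v q (u q)"
  have I: "(?f has_integral (u r - u s)) {s..r}" if "r \<in> {s..t}" for r
    using integral_curve_onD[OF assms _ that] that True by auto
  have "continuous_on {s..t} (\<lambda>r. u s + integral {s..r} ?f)"
    using I[of t] True
    by (intro continuous_intros indefinite_integral_continuous_1) auto
  then show ?thesis
    by (rule continuous_on_eq) (use I in \<open>force simp: integral_unique\<close>)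
qed auto

lemma has_integral_norm_bound_interior:
  fixes f :: "real \<Rightarrow> 'a::real_normed_vector"
  assumes "(f has_integral i) {a..b}" "a \<le> b" "0 \<le> K"
    and "\<And>q. a < q \<Longrightarrow> q < b \<Longrightarrow> norm (f q) \<le> K"
  shows "norm i \<le> K * (b - a)"
  using has_integral_bound_real[of K "{a,b}" f i a b] assms by force

lemma has_integral_deviation_bound:
  fixes f :: "real \<Rightarrow> 'a::euclidean_space"
  assumes "(f has_integral i) {a..b}" "a \<le> b" "0 \<le> K"
    and "\<And>q. a < q \<Longrightarrow> q < b \<Longrightarrow> norm (f q - c) \<le> K"
  shows "norm (i - (b - a) *\<^sub>R c) \<le> K * (b - a)"
proof -
  have "((\<lambda>q. f q - c) has_integral (i - (b - a) *\<^sub>R c)) {a..b}"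
    using has_integral_diff[OF assms(1) has_integral_const_real[of c a b]] assms(2) by simp
  then show ?thesis
    by (rule has_integral_norm_bound_interior) (use assms in auto)
qed

text \<open>
  A substitute for Gronwall's inequality on intervals so short that \<open>L (t - s) \<le> 1/2\<close>: evaluating the
  integral inequality at the time where \<open>norm d\<close> is largest bounds that maximum by
  \<open>2 * norm (d s)\<close>, and then the total change by \<open>L (t - s)\<close> times the maximum.
\<close>

lemma short_time_deviation_bound:
  fixes d :: "real \<Rightarrow> 'a::euclidean_space"
  assumes "s \<le> t" "0 \<le> L" "L * (t - s) \<le> 1 / 2"
    and cont: "continuous_on {s..t} d"
    and I: "\<And>r. r \<in> {s..t} \<Longrightarrow> (f has_integral (d r - d s)) {s..r}"
    and f: "\<And>q. s < q \<Longrightarrow> q < t \<Longrightarrow> norm (f q) \<le> L * norm (d q)"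
  shows "norm (d t - d s) \<le> 2 * L * (t - s) * norm (d s)"
proof -
  have "continuous_on {s..t} (\<lambda>q. norm (d q))" using cont by (intro continuous_intros)
  then obtain m where m: "m \<in> {s..t}" "\<And>q. q \<in> {s..t} \<Longrightarrow> norm (d q) \<le> norm (d m)"
    using continuous_attains_sup[of "{s..t}" "\<lambda>q. norm (d q)"] assms(1) by auto
  have B: "norm (d r - d s) \<le> L * norm (d m) * (r - s)" if r: "r \<in> {s..t}" for r
  proof (rule has_integral_norm_bound_interior[OF I[OF r]])
    fix q assume "s < q" "q < r"
    then show "norm (f q) \<le> L * norm (d m)"
      using f[of q] mult_left_mono[OF m(2)[of q] assms(2)] r by fastforce
  qed (use r assms in auto)
  have "norm (d m - d s) \<le> L * (m - s) * norm (d m)" using B[OF m(1)] by (simp add: mult_ac)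
  also have "\<dots> \<le> L * (t - s) * norm (d m)"
    using m(1) assms(2) by (intro mult_right_mono mult_left_mono) auto
  also have "\<dots> \<le> 1 / 2 * norm (d m)" using assms(3) by (intro mult_right_mono) auto
  finally have "norm (d m) \<le> 2 * norm (d s)"
    using norm_triangle_ineq2[of "d m" "d s"] by linarith
  then have "L * (t - s) * norm (d m) \<le> L * (t - s) * (2 * norm (d s))"
    using assms by (intro mult_left_mono) auto
  moreover have "norm (d t - d s) \<le> L * (t - s) * norm (d m)"
    using B[of t] assms(1) by (simp add: mult_ac)
  ultimately have "norm (d t - d s) \<le> L * (t - s) * (2 * norm (d s))" by linarith
  then show ?thesis by (simp only: mult_ac)
qed

text \<open>
  The speed bound \<open>V\<close> is available only inside the ball, so the argument stops at the first exit time: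
  up to then the curve has moved by at most \<open>V (t - s)\<close>, too little to have reached the sphere.
\<close>

lemma integral_curve_stays_in_ball:
  assumes u: "integral_curve_on v {s..t} u"
    and V: "0 \<le> V" "\<And>q x. q \<in> {s..t} \<Longrightarrow> x \<in> ball c \<rho> \<Longrightarrow> norm (v q x) \<le> V"
    and start: "norm (u s - c) + V * (t - s) < \<rho>"
    and r: "r \<in> {s..t}"
  shows "u r \<in> ball c \<rho>"
proof (rule ccontr)
  assume "u r \<notin> ball c \<rho>"
  define X where "X = {q \<in> {s..t}. \<rho> \<le> norm (u q - c)}"
  have "continuous_on {s..t} (\<lambda>q. norm (u q - c))"
    using integral_curve_on_continuous[OF u] by (intro continuous_intros)
  then have "closed ({s..t} \<inter> (\<lambda>q. norm (u q - c)) -` {\<rho>..})"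
    by (intro continuous_closed_preimage) auto
  also have "{s..t} \<inter> (\<lambda>q. norm (u q - c)) -` {\<rho>..} = X" unfolding X_def by auto
  finally have "closed X" .
  moreover have "X \<noteq> {}" using \<open>u r \<notin> ball c \<rho>\<close> r by (auto simp: X_def dist_norm norm_minus_commute)
  moreover have bdd: "bdd_below X" unfolding X_def by (intro bdd_belowI[of _ s]) auto
  ultimately have "Inf X \<in> X" by (intro closed_contains_Inf) auto
  then have m: "Inf X \<in> {s..t}" "\<rho> \<le> norm (u (Inf X) - c)" by (auto simp: X_def)
  have before: "u q \<in> ball c \<rho>" if "s < q" "q < Inf X" for q
  proof (rule ccontr)
    assume "u q \<notin> ball c \<rho>"
    then have "q \<in> X" using that m by (simp add: X_def dist_norm norm_minus_commute)
    with that bdd show False using cInf_lower by force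
  qed
  have "norm (u (Inf X) - u s) \<le> V * (Inf X - s)"
    using m(1) V before
    by (intro has_integral_norm_bound_interior[OF integral_curve_onD[OF u, of s "Inf X"]]) auto
  also have "\<dots> \<le> V * (t - s)" using m(1) V by (intro mult_left_mono) auto
  finally have "norm (u (Inf X) - c) < \<rho>"
    using start norm_triangle_ineq[of "u (Inf X) - u s" "u s - c"] by simp
  with m show False by simp
qed

section \<open>Curves in a linearised neighbourhood of the boundary\<close>

text \<open>
  A bound for the speed in the neighbourhoods considered below; the summand \<open>1\<close> absorbs the
  oscillation of the fields there.
\<close>

definition speed_bound :: "'a::real_normed_vector \<Rightarrow> 'a \<Rightarrow> real" where
  "speed_bound wm wp = norm wm + norm wp + 1"

definition saltation_map :: "'a::real_inner \<Rightarrow> 'a \<Rightarrow> 'a \<Rightarrow> real \<Rightarrow> 'a \<Rightarrow> 'a" where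
  "saltation_map wm wp g ht x = x + ((g \<bullet> x) / (ht + g \<bullet> wm)) *\<^sub>R (wp - wm)"

text \<open>
  The next three constants depend on the linearised data only: \<open>\<alpha>\<close> is a lower bound for the two rates at
  which the level function grows. They bound, relative to the distance of two curves, the time between
  their crossings, and, after division by \<open>\<eta>\<close>, the error in the saltation formula over the time between
  the crossings and over the whole passage.
\<close>

definition delay_bound :: "'a::real_normed_vector \<Rightarrow> real \<Rightarrow> real" where
  "delay_bound g \<alpha> = 2 * (norm g + 1) / \<alpha>"

definition jump_error :: "'a::real_normed_vector \<Rightarrow> 'a \<Rightarrow> 'a \<Rightarrow> real \<Rightarrow> real" where
  "jump_error wm wp g \<alpha> = 2 * delay_bound g \<alpha>
     + (delay_bound g \<alpha> * (norm g + 1 + speed_bound wm wp) + 1) / \<alpha> * speed_bound wm wp"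

definition saltation_error :: "'a::real_normed_vector \<Rightarrow> 'a \<Rightarrow> 'a \<Rightarrow> real \<Rightarrow> real" where
  "saltation_error wm wp g \<alpha> =
     2 * (jump_error wm wp g \<alpha> + 1 + 2 * speed_bound wm wp * delay_bound g \<alpha>)
     + 1 + norm g * speed_bound wm wp / \<alpha>"

text \<open>
  A space-time region \<open>B\<close> around a point of the switching boundary, so small that it is close to the
  model situation: the two fields have constant values \<open>wm\<close> and \<open>wp\<close> up to \<open>\<eta>\<close>, and the increments of the
  level function \<open>h\<close> are those of an affine function with time derivative \<open>ht\<close> and gradient \<open>g\<close>, up to \<open>\<eta>\<close>
  times the distance. Crossing happens from \<open>h < 0\<close> to \<open>h > 0\<close>. The Lipschitz constant \<open>L\<close> does not shrink
  with \<open>\<eta>\<close>; its effect is kept small by short time intervals instead.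
\<close>

locale switching_box =
  fixes B :: "(real \<times> 'a::euclidean_space) set"
    and v vm vp :: "real \<Rightarrow> 'a \<Rightarrow> 'a"
    and h :: "real \<Rightarrow> 'a \<Rightarrow> real"
    and wm wp g :: 'a
    and ht L \<eta> :: real
  assumes L_nonneg: "0 \<le> L" and eta: "0 < \<eta>" "\<eta> \<le> 1"
    and vm_close: "\<And>t x. (t, x) \<in> B \<Longrightarrow> h t x \<le> 0 \<Longrightarrow> norm (vm t x - wm) \<le> \<eta>"
    and vp_close: "\<And>t x. (t, x) \<in> B \<Longrightarrow> 0 \<le> h t x \<Longrightarrow> norm (vp t x - wp) \<le> \<eta>"
    and vm_lip: "\<And>t x y. (t, x) \<in> B \<Longrightarrow> (t, y) \<in> B \<Longrightarrow> h t x \<le> 0 \<Longrightarrow> h t y \<le> 0 \<Longrightarrow>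
                   norm (vm t x - vm t y) \<le> L * norm (x - y)"
    and vp_lip: "\<And>t x y. (t, x) \<in> B \<Longrightarrow> (t, y) \<in> B \<Longrightarrow> 0 \<le> h t x \<Longrightarrow> 0 \<le> h t y \<Longrightarrow>
                   norm (vp t x - vp t y) \<le> L * norm (x - y)"
    and v_before: "\<And>t x. (t, x) \<in> B \<Longrightarrow> h t x < 0 \<Longrightarrow> v t x = vm t x"
    and v_after: "\<And>t x. (t, x) \<in> B \<Longrightarrow> 0 < h t x \<Longrightarrow> v t x = vp t x"
    and v_on: "\<And>t x. (t, x) \<in> B \<Longrightarrow> h t x = 0 \<Longrightarrow> v t x \<in> closed_segment (vm t x) (vp t x)"
    and h_linear: "\<And>t x r y. (t, x) \<in> B \<Longrightarrow> (r, y) \<in> B \<Longrightarrow>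
                   \<bar>h t x - h r y - (ht * (t - r) + g \<bullet> (x - y))\<bar> \<le> \<eta> * (\<bar>t - r\<bar> + norm (x - y))"
begin

abbreviation speed :: real where "speed \<equiv> speed_bound wm wp"

definition curve_in_box :: "real \<Rightarrow> real \<Rightarrow> (real \<Rightarrow> 'a) \<Rightarrow> bool" where
  "curve_in_box s t u \<longleftrightarrow> integral_curve_on v {s..t} u \<and> (\<forall>q\<in>{s..t}. (q, u q) \<in> B)"

lemma curve_in_boxD:
  assumes "curve_in_box s t u"
  shows "s \<le> q \<Longrightarrow> q \<le> t \<Longrightarrow> (q, u q) \<in> B"
    and "s \<le> a \<Longrightarrow> a \<le> b \<Longrightarrow> b \<le> t \<Longrightarrow> ((\<lambda>q. v q (u q)) has_integral (u b - u a)) {a..b}"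
    and "continuous_on {s..t} u"
  using assms integral_curve_onD[of v "{s..t}" u a b] integral_curve_on_continuous
  unfolding curve_in_box_def by auto

lemma level_lipschitz:
  assumes "(t, x) \<in> B" "(t, y) \<in> B"
  shows "\<bar>h t x - h t y\<bar> \<le> (norm g + 1) * norm (x - y)"
proof -
  have "\<bar>h t x - h t y - g \<bullet> (x - y)\<bar> \<le> \<eta> * norm (x - y)"
    using h_linear[OF assms] by simp
  moreover have "\<eta> * norm (x - y) \<le> 1 * norm (x - y)"
    using eta by (intro mult_right_mono) auto
  ultimately show ?thesis using Cauchy_Schwarz_ineq2[of g "x - y"] by (simp add: algebra_simps)
qed

lemma curve_in_box_mono: "curve_in_box s t u \<Longrightarrow> s \<le> a \<Longrightarrow> b \<le> t \<Longrightarrow> curve_in_box a b u"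
  unfolding curve_in_box_def by (auto intro: integral_curve_on_subset)

lemma curve_diff_integral:
  assumes "curve_in_box s t u" "curve_in_box s t w" "s \<le> a" "a \<le> b" "b \<le> t"
  shows "((\<lambda>q. v q (w q) - v q (u q)) has_integral ((w b - u b) - (w a - u a))) {a..b}"
proof -
  have "((\<lambda>q. v q (w q) - v q (u q)) has_integral ((w b - w a) - (u b - u a))) {a..b}"
    using assms by (intro has_integral_diff curve_in_boxD(2)) auto
  moreover have "(w b - w a) - (u b - u a) = (w b - u b) - (w a - u a)" by simp
  ultimately show ?thesis by simp
qed

text \<open>
  On the boundary itself the velocity is a convex combination of the one-sided values, so in all three
  cases it is within \<open>\<eta>\<close> of the segment between \<open>wm\<close> and \<open>wp\<close>.
\<close>

lemma velocity_near_segment: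
  assumes "(q, x) \<in> B"
  obtains \<theta> where "0 \<le> \<theta>" "\<theta> \<le> 1" "norm (v q x - ((1 - \<theta>) *\<^sub>R wm + \<theta> *\<^sub>R wp)) \<le> \<eta>"
proof (cases "h q x" "0::real" rule: linorder_cases)
  case less
  then show ?thesis using that[of 0] v_before[OF assms] vm_close[OF assms] by simp
next
  case greater
  then show ?thesis using that[of 1] v_after[OF assms] vp_close[OF assms] by simp
next
  case equal
  then obtain \<theta> where \<theta>: "0 \<le> \<theta>" "\<theta> \<le> 1" "v q x = (1 - \<theta>) *\<^sub>R vm q x + \<theta> *\<^sub>R vp q x"
    using v_on[OF assms] by (auto simp: in_segment)
  have "v q x - ((1 - \<theta>) *\<^sub>R wm + \<theta> *\<^sub>R wp) = (1 - \<theta>) *\<^sub>R (vm q x - wm) + \<theta> *\<^sub>R (vp q x - wp)"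
    by (simp add: \<theta>(3) algebra_simps)
  also have "norm \<dots> \<le> (1 - \<theta>) * norm (vm q x - wm) + \<theta> * norm (vp q x - wp)"
    using \<theta> by (intro order_trans[OF norm_triangle_ineq]) simp
  also have "\<dots> \<le> \<eta>"
    using \<theta> vm_close[OF assms] vp_close[OF assms] equal by (intro convex_bound_le) auto
  finally show ?thesis using that \<theta> by blast
qed

lemma speed_pos: "0 < speed"
  unfolding speed_bound_def by (simp add: add_nonneg_pos)

lemma velocity_le_speed:
  assumes "(q, x) \<in> B"
  shows "norm (v q x) \<le> speed"
proof -
  obtain \<theta> where \<theta>: "0 \<le> \<theta>" "\<theta> \<le> 1" "norm (v q x - ((1 - \<theta>) *\<^sub>R wm + \<theta> *\<^sub>R wp)) \<le> \<eta>"
    using velocity_near_segment[OF assms] .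
  have "norm ((1 - \<theta>) *\<^sub>R wm + \<theta> *\<^sub>R wp) \<le> (1 - \<theta>) * norm wm + \<theta> * norm wp"
    using \<theta> by (intro order_trans[OF norm_triangle_ineq]) simp
  also have "\<dots> \<le> norm wm + norm wp"
    using \<theta> by (intro add_mono) (auto simp: mult_left_le_one_le)
  finally show ?thesis
    using \<theta>(3) eta norm_triangle_sub[of "v q x" "(1 - \<theta>) *\<^sub>R wm + \<theta> *\<^sub>R wp"]
    unfolding speed_bound_def by linarith
qed

lemma curve_displacement_le:
  assumes "curve_in_box s t u" "s \<le> t"
  shows "norm (u t - u s) \<le> speed * (t - s)"
  using assms speed_pos
  by (intro has_integral_norm_bound_interior[OF curve_in_boxD(2)[OF assms(1)]] velocity_le_speed
        curve_in_boxD(1)[OF assms(1)]) auto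

text \<open>
  While the velocity is nearly \<open>k\<close>, the level function grows along the curve at nearly the rate
  \<open>ht + g \<bullet> k\<close>. Instead of differentiating \<open>h\<close> along a curve that need not be differentiable, the
  affine approximation of \<open>h\<close> is applied to the two end points.
\<close>

lemma increment_constant_velocity:
  assumes u: "curve_in_box s t u" "s \<le> t"
    and near: "\<And>q. s < q \<Longrightarrow> q < t \<Longrightarrow> norm (v q (u q) - k) \<le> \<eta>"
  shows "\<bar>h t (u t) - h s (u s) - (t - s) * (ht + g \<bullet> k)\<bar> \<le> \<eta> * (norm g + 1 + speed) * (t - s)"
proof -
  have "norm (u t - u s - (t - s) *\<^sub>R k) \<le> \<eta> * (t - s)"
    using curve_in_boxD(2)[OF u(1), of s t] u(2) near eta
    by (intro has_integral_deviation_bound) auto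
  then have "norm g * norm (u t - u s - (t - s) *\<^sub>R k) \<le> norm g * (\<eta> * (t - s))"
    by (intro mult_left_mono) auto
  then have 1: "\<bar>g \<bullet> (u t - u s - (t - s) *\<^sub>R k)\<bar> \<le> norm g * (\<eta> * (t - s))"
    using Cauchy_Schwarz_ineq2 order_trans by blast
  have "\<bar>h t (u t) - h s (u s) - (ht * (t - s) + g \<bullet> (u t - u s))\<bar> \<le> \<eta> * (\<bar>t - s\<bar> + norm (u t - u s))"
    using curve_in_boxD(1)[OF u(1)] u(2) by (intro h_linear) auto
  also have "\<dots> \<le> \<eta> * ((t - s) + speed * (t - s))"
    using eta u(2) curve_displacement_le[OF u] by (intro mult_left_mono add_mono) auto
  finally have 2: "\<bar>h t (u t) - h s (u s) - (ht * (t - s) + g \<bullet> (u t - u s))\<bar>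
      \<le> \<eta> * ((t - s) + speed * (t - s))" .
  have "h t (u t) - h s (u s) - (t - s) * (ht + g \<bullet> k)
      = (h t (u t) - h s (u s) - (ht * (t - s) + g \<bullet> (u t - u s))) + g \<bullet> (u t - u s - (t - s) *\<^sub>R k)"
    by (simp add: inner_diff_right algebra_simps)
  then have "\<bar>h t (u t) - h s (u s) - (t - s) * (ht + g \<bullet> k)\<bar>
      \<le> \<eta> * ((t - s) + speed * (t - s)) + norm g * (\<eta> * (t - s))"
    using 1 2 by linarith
  also have "\<dots> = \<eta> * (norm g + 1 + speed) * (t - s)" by (simp add: algebra_simps)
  finally show ?thesis .
qed

lemma approach_rate_lower_bound:
  assumes u: "curve_in_box s t u" "s < t"
    and h: "\<And>q. s \<le> q \<Longrightarrow> q < t \<Longrightarrow> h q (u q) < 0" "h t (u t) = 0"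
  shows "- (\<eta> * (norm g + 1 + speed)) \<le> ht + g \<bullet> wm"
proof -
  have "norm (v q (u q) - wm) \<le> \<eta>" if "s < q" "q < t" for q
    using curve_in_boxD(1)[OF u(1), of q] that h(1)[of q] v_before vm_close[of q "u q"] by simp
  from increment_constant_velocity[OF u(1) _ this] u(2) h(1)[of s] h(2)
  have "(t - s) * (ht + g \<bullet> wm) \<ge> (t - s) * - (\<eta> * (norm g + 1 + speed))"
    by (simp add: abs_le_iff algebra_simps)
  then show ?thesis by (rule mult_left_le_imp_le) (use u(2) in simp)
qed

lemma departure_rate_lower_bound:
  assumes u: "curve_in_box s t u" "s < t"
    and h: "\<And>q. s < q \<Longrightarrow> q \<le> t \<Longrightarrow> 0 < h q (u q)" "h s (u s) = 0"
  shows "- (\<eta> * (norm g + 1 + speed)) \<le> ht + g \<bullet> wp"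
proof -
  have "norm (v q (u q) - wp) \<le> \<eta>" if "s < q" "q < t" for q
    using curve_in_boxD(1)[OF u(1), of q] that h(1)[of q] v_after vp_close[of q "u q"] by simp
  from increment_constant_velocity[OF u(1) _ this] u(2) h(1)[of t] h(2)
  have "(t - s) * (ht + g \<bullet> wp) \<ge> (t - s) * - (\<eta> * (norm g + 1 + speed))"
    by (simp add: abs_le_iff algebra_simps)
  then show ?thesis by (rule mult_left_le_imp_le) (use u(2) in simp)
qed

end

text \<open>
  With \<open>\<eta>\<close> small compared with the two rates, the errors of the affine model cannot stop the level
  function from growing along curves.
\<close>

locale transversal_box = switching_box +
  fixes \<alpha> :: real
  assumes alpha_pos: "0 < \<alpha>"
    and rate_before: "\<alpha> \<le> ht + g \<bullet> wm"
    and rate_after: "\<alpha> \<le> ht + g \<bullet> wp"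
    and eta_small: "\<eta> * (norm g + 1 + speed) \<le> \<alpha> / 2"
begin

abbreviation delay_const :: real where "delay_const \<equiv> delay_bound g \<alpha>"

abbreviation jump_const :: real where "jump_const \<equiv> jump_error wm wp g \<alpha>"

abbreviation S :: "'a \<Rightarrow> 'a" where "S \<equiv> saltation_map wm wp g ht"

text \<open>
  This is what makes the crossing clean. By convexity the rate is at least \<open>\<alpha>\<close> for every velocity on the
  segment between \<open>wm\<close> and \<open>wp\<close>, hence at least \<open>\<alpha> / 2\<close> for every velocity that occurs in the box,
  those on the boundary included. So each curve meets the boundary at most once and cannot slide.
\<close>

lemma level_growth:
  assumes u: "curve_in_box s t u" "s \<le> t"
  shows "\<alpha> / 2 * (t - s) \<le> h t (u t) - h s (u s)"
proof -
  have rate: "\<alpha> - \<eta> * norm g \<le> ht + g \<bullet> v q (u q)" if q: "q \<in> {s..t}" for q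
  proof -
    have "(q, u q) \<in> B" using curve_in_boxD(1)[OF u(1)] q by auto
    then obtain \<theta> where \<theta>: "0 \<le> \<theta>" "\<theta> \<le> 1"
        "norm (v q (u q) - ((1 - \<theta>) *\<^sub>R wm + \<theta> *\<^sub>R wp)) \<le> \<eta>"
      using velocity_near_segment by blast
    let ?k = "(1 - \<theta>) *\<^sub>R wm + \<theta> *\<^sub>R wp"
    have "ht + g \<bullet> ?k = (1 - \<theta>) * (ht + g \<bullet> wm) + \<theta> * (ht + g \<bullet> wp)"
      by (simp add: inner_add_right algebra_simps)
    also have "\<dots> \<ge> (1 - \<theta>) * \<alpha> + \<theta> * \<alpha>"
      using \<theta> rate_before rate_after by (intro add_mono mult_left_mono) auto
    finally have "\<alpha> \<le> ht + g \<bullet> ?k" by (simp add: algebra_simps)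
    moreover have "\<bar>g \<bullet> (v q (u q) - ?k)\<bar> \<le> norm g * \<eta>"
      using Cauchy_Schwarz_ineq2[of g "v q (u q) - ?k"] mult_left_mono[OF \<theta>(3), of "norm g"] by simp
    ultimately show ?thesis by (simp add: inner_diff_right abs_le_iff mult.commute)
  qed
  have rate_integral: "((\<lambda>q. ht + g \<bullet> v q (u q)) has_integral (ht * (t - s) + g \<bullet> (u t - u s))) {s..t}"
    using has_integral_add[OF has_integral_const_real[of ht s t]
        has_integral_linear[OF curve_in_boxD(2)[OF u(1), of s t] bounded_linear_inner_right[of g]]] u(2)
    by (simp add: o_def mult.commute)
  have bound_integral: "((\<lambda>q. \<alpha> - \<eta> * norm g) has_integral (t - s) * (\<alpha> - \<eta> * norm g)) {s..t}"
    using has_integral_const_real[of "\<alpha> - \<eta> * norm g" s t] u(2) by simp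
  have 1: "(t - s) * (\<alpha> - \<eta> * norm g) \<le> ht * (t - s) + g \<bullet> (u t - u s)"
    by (rule has_integral_le[OF bound_integral rate_integral rate])
  have "\<bar>h t (u t) - h s (u s) - (ht * (t - s) + g \<bullet> (u t - u s))\<bar> \<le> \<eta> * (\<bar>t - s\<bar> + norm (u t - u s))"
    using curve_in_boxD(1)[OF u(1)] u(2) by (intro h_linear) auto
  also have "\<dots> \<le> \<eta> * ((t - s) + speed * (t - s))"
    using eta u(2) curve_displacement_le[OF u] by (intro mult_left_mono add_mono) auto
  finally have "(t - s) * (\<alpha> - \<eta> * norm g) - \<eta> * ((t - s) + speed * (t - s)) \<le> h t (u t) - h s (u s)"
    using 1 by linarith
  moreover have "(t - s) * (\<alpha> - \<eta> * norm g) - \<eta> * ((t - s) + speed * (t - s))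
      = (t - s) * (\<alpha> - \<eta> * (norm g + 1 + speed))" by (simp add: algebra_simps)
  moreover have "(t - s) * (\<alpha> / 2) \<le> (t - s) * (\<alpha> - \<eta> * (norm g + 1 + speed))"
    using u(2) eta_small by (intro mult_left_mono) auto
  ultimately show ?thesis by (simp add: mult.commute)
qed

lemma level_strict_mono:
  assumes "curve_in_box s t u" "s \<le> a" "a < b" "b \<le> t"
  shows "h a (u a) < h b (u b)"
proof -
  have "0 < \<alpha> / 2 * (b - a)" using alpha_pos assms(3) by simp
  then show ?thesis
    using level_growth[OF curve_in_box_mono[OF assms(1,2,4)]] assms(3) by simp
qed

text \<open>
  Since the level function grows along both curves, being on the incoming side at the end means having
  been there throughout; the two velocities are then values of the same Lipschitz field.
\<close>

lemma deviation_before: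
  assumes u: "curve_in_box s t u" "h t (u t) \<le> 0" and w: "curve_in_box s t w" "h t (w t) \<le> 0"
    and t: "s \<le> t" "L * (t - s) \<le> 1 / 2"
  shows "norm ((w t - u t) - (w s - u s)) \<le> 2 * L * (t - s) * norm (w s - u s)"
proof (rule short_time_deviation_bound[where d = "\<lambda>q. w q - u q"])
  show "continuous_on {s..t} (\<lambda>q. w q - u q)"
    using curve_in_boxD(3) u w by (intro continuous_intros) auto
  show "((\<lambda>q. v q (w q) - v q (u q)) has_integral ((w r - u r) - (w s - u s))) {s..r}"
    if "r \<in> {s..t}" for r
    using that by (intro curve_diff_integral[OF u(1) w(1)]) auto
  show "norm (v q (w q) - v q (u q)) \<le> L * norm (w q - u q)" if q: "s < q" "q < t" for q
  proof -
    have "h q (u q) < 0" "h q (w q) < 0"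
      using level_strict_mono[OF u(1), of q t] level_strict_mono[OF w(1), of q t] q u(2) w(2) by auto
    moreover have "(q, u q) \<in> B" "(q, w q) \<in> B" using curve_in_boxD(1) u(1) w(1) q by auto
    ultimately show ?thesis using v_before vm_lip by simp
  qed
qed (use L_nonneg t in auto)

lemma deviation_after:
  assumes u: "curve_in_box s t u" "0 \<le> h s (u s)" and w: "curve_in_box s t w" "0 \<le> h s (w s)"
    and t: "s \<le> t" "L * (t - s) \<le> 1 / 2"
  shows "norm ((w t - u t) - (w s - u s)) \<le> 2 * L * (t - s) * norm (w s - u s)"
proof (rule short_time_deviation_bound[where d = "\<lambda>q. w q - u q"])
  show "continuous_on {s..t} (\<lambda>q. w q - u q)"
    using curve_in_boxD(3) u w by (intro continuous_intros) auto
  show "((\<lambda>q. v q (w q) - v q (u q)) has_integral ((w r - u r) - (w s - u s))) {s..r}"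
    if "r \<in> {s..t}" for r
    using that by (intro curve_diff_integral[OF u(1) w(1)]) auto
  show "norm (v q (w q) - v q (u q)) \<le> L * norm (w q - u q)" if q: "s < q" "q < t" for q
  proof -
    have "0 < h q (u q)" "0 < h q (w q)"
      using level_strict_mono[OF u(1), of s q] level_strict_mono[OF w(1), of s q] q u(2) w(2) by auto
    moreover have "(q, u q) \<in> B" "(q, w q) \<in> B" using curve_in_boxD(1) u(1) w(1) q by auto
    ultimately show ?thesis using v_after vp_lip by simp
  qed
qed (use L_nonneg t in auto)

lemma rate_pos: "0 < ht + g \<bullet> wm"
  using alpha_pos rate_before by linarith

lemma delay_const_pos: "0 < delay_const"
  unfolding delay_bound_def using alpha_pos by (intro divide_pos_pos) (auto intro: add_nonneg_pos)

lemma jump_speed_le: "norm (wp - wm) \<le> speed"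
  unfolding speed_bound_def using norm_triangle_ineq4[of wp wm] by linarith

lemma saltation_map_diff: "S (x - y) = S x - S y"
  unfolding saltation_map_def
  by (simp add: inner_diff_right diff_divide_distrib scaleR_left_diff_distrib)

lemma saltation_map_bound: "norm (S x) \<le> (1 + norm g * speed / \<alpha>) * norm x"
proof -
  have "\<bar>(g \<bullet> x) / (ht + g \<bullet> wm)\<bar> \<le> norm g * norm x / \<alpha>"
    using Cauchy_Schwarz_ineq2[of g x] rate_before alpha_pos rate_pos
    by (simp add: abs_divide) (intro frac_le, auto)
  then have "\<bar>(g \<bullet> x) / (ht + g \<bullet> wm)\<bar> * norm (wp - wm) \<le> norm g * norm x / \<alpha> * speed"
    using jump_speed_le alpha_pos by (intro mult_mono) auto
  moreover have "norm (S x) \<le> norm x + \<bar>(g \<bullet> x) / (ht + g \<bullet> wm)\<bar> * norm (wp - wm)"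
    unfolding saltation_map_def by (rule order_trans[OF norm_triangle_ineq]) simp
  ultimately show ?thesis by (simp add: algebra_simps)
qed

text \<open>
  At the time \<open>a\<close> when \<open>u\<close> crosses, the level of \<open>w\<close> is below zero by at most a multiple of the distance
  of the curves, and it climbs at the rate \<open>\<alpha> / 2\<close> at least.
\<close>

lemma crossing_delay_le:
  assumes u: "curve_in_box a b u" "h a (u a) = 0" and w: "curve_in_box a b w" "h b (w b) = 0"
    and ab: "a \<le> b"
  shows "b - a \<le> delay_const * norm (w a - u a)"
proof -
  have "- h a (w a) \<le> (norm g + 1) * norm (w a - u a)"
    using level_lipschitz[of a "w a" "u a"] curve_in_boxD(1) u w ab by (simp add: abs_le_iff)
  moreover have "\<alpha> / 2 * (b - a) \<le> - h a (w a)" using level_growth[OF w(1) ab] w(2) by simp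
  ultimately have "\<alpha> / 2 * (b - a) \<le> (norm g + 1) * norm (w a - u a)"
    by (simp add: algebra_simps)
  then show ?thesis unfolding delay_bound_def using alpha_pos by (simp add: field_simps)
qed

text \<open>
  Here the rank-one term arises. Between the crossing times \<open>w\<close> still moves with velocity \<open>wm\<close> and \<open>u\<close>
  already with \<open>wp\<close>, so their difference changes by about \<open>(b - a) (wm - wp)\<close>. Linearising
  \<open>h b (w b) = h a (u a) = 0\<close> gives \<open>(b - a) (ht + g \<bullet> wm) + g \<bullet> (w a - u a) \<approx> 0\<close>, which determines the
  delay \<open>b - a\<close>.
\<close>

lemma crossing_jump:
  assumes u: "curve_in_box a b u" "h a (u a) = 0" and w: "curve_in_box a b w" "h b (w b) = 0"
    and ab: "a \<le> b"
  shows "norm ((w b - u b) - S (w a - u a)) \<le> \<eta> * jump_const * norm (w a - u a)"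
    and "norm (w b - u b) \<le> (1 + 2 * speed * delay_const) * norm (w a - u a)"
proof -
  let ?c = "norm (w a - u a)"
  let ?A = "ht + g \<bullet> wm"
  have delay: "b - a \<le> delay_const * ?c" by (rule crossing_delay_le[OF u w ab])
  have wm_near: "norm (v q (w q) - wm) \<le> \<eta>" if q: "a < q" "q < b" for q
    using level_strict_mono[OF w(1), of q b] q w(2) curve_in_boxD(1)[OF w(1), of q]
      v_before vm_close[of q "w q"] by simp
  have wp_near: "norm (v q (u q) - wp) \<le> \<eta>" if q: "a < q" "q < b" for q
    using level_strict_mono[OF u(1), of a q] q u(2) curve_in_boxD(1)[OF u(1), of q]
      v_after vp_close[of q "u q"] by simp
  have w_disp: "norm (w b - w a - (b - a) *\<^sub>R wm) \<le> \<eta> * (b - a)"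
    using curve_in_boxD(2)[OF w(1), of a b] ab wm_near eta
    by (intro has_integral_deviation_bound) auto
  have u_disp: "norm (u b - u a - (b - a) *\<^sub>R wp) \<le> \<eta> * (b - a)"
    using curve_in_boxD(2)[OF u(1), of a b] ab wp_near eta
    by (intro has_integral_deviation_bound) auto
  have split: "(w b - u b) - (w a - u a) - (b - a) *\<^sub>R (wm - wp)
      = (w b - w a - (b - a) *\<^sub>R wm) - (u b - u a - (b - a) *\<^sub>R wp)"
    by (simp add: algebra_simps)
  have jump: "norm ((w b - u b) - (w a - u a) - (b - a) *\<^sub>R (wm - wp)) \<le> 2 * \<eta> * (b - a)"
    unfolding split by (rule norm_triangle_le_diff) (use w_disp u_disp in linarith)
  show "norm (w b - u b) \<le> (1 + 2 * speed * delay_const) * ?c"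
  proof -
    have "norm ((w b - w a) - (u b - u a)) \<le> 2 * speed * (b - a)"
      using curve_displacement_le[OF u(1) ab] curve_displacement_le[OF w(1) ab]
        norm_triangle_ineq4[of "w b - w a" "u b - u a"] by simp
    also have "\<dots> \<le> 2 * speed * (delay_const * ?c)"
      using delay speed_pos by (intro mult_left_mono) auto
    finally have "norm ((w b - w a) - (u b - u a)) \<le> 2 * speed * (delay_const * ?c)" .
    moreover have "w b - u b = ((w b - w a) - (u b - u a)) + (w a - u a)" by simp
    ultimately have "norm (w b - u b) \<le> 2 * speed * (delay_const * ?c) + ?c"
      using norm_triangle_ineq[of "(w b - w a) - (u b - u a)" "w a - u a"] by (metis add_right_mono order_trans)
    then show ?thesis by (simp add: algebra_simps)
  qed
  \<comment> \<open>The linearised crossing condition.\<close>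
  have lin: "\<bar>(b - a) * ?A + g \<bullet> (w a - u a)\<bar> \<le> \<eta> * (delay_const * (norm g + 1 + speed) + 1) * ?c"
  proof -
    have "\<bar>h b (w b) - h a (u a) - (ht * (b - a) + g \<bullet> (w b - u a))\<bar> \<le> \<eta> * (\<bar>b - a\<bar> + norm (w b - u a))"
      using curve_in_boxD(1) u w ab by (intro h_linear) auto
    moreover have "norm (w b - u a) \<le> ?c + speed * (b - a)"
      using curve_displacement_le[OF w(1) ab] norm_triangle_ineq[of "w b - w a" "w a - u a"] by simp
    then have "\<eta> * (\<bar>b - a\<bar> + norm (w b - u a)) \<le> \<eta> * ((b - a) + (?c + speed * (b - a)))"
      using eta ab by (intro mult_left_mono add_mono) auto
    ultimately have 1: "\<bar>ht * (b - a) + g \<bullet> (w b - u a)\<bar> \<le> \<eta> * ((b - a) + (?c + speed * (b - a)))"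
      using u(2) w(2) by simp
    have 2: "\<bar>g \<bullet> (w b - w a - (b - a) *\<^sub>R wm)\<bar> \<le> norm g * (\<eta> * (b - a))"
      using Cauchy_Schwarz_ineq2[of g "w b - w a - (b - a) *\<^sub>R wm"]
        mult_left_mono[OF w_disp, of "norm g"] by simp
    have "(b - a) * ?A + g \<bullet> (w a - u a)
        = (ht * (b - a) + g \<bullet> (w b - u a)) - g \<bullet> (w b - w a - (b - a) *\<^sub>R wm)"
      by (simp add: inner_diff_right algebra_simps)
    then have "\<bar>(b - a) * ?A + g \<bullet> (w a - u a)\<bar>
        \<le> \<eta> * ((b - a) + (?c + speed * (b - a))) + norm g * (\<eta> * (b - a))"
      using 1 2 by linarith
    also have "\<dots> = \<eta> * ((norm g + 1 + speed) * (b - a) + ?c)" by (simp add: algebra_simps)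
    also have "\<dots> \<le> \<eta> * ((norm g + 1 + speed) * (delay_const * ?c) + ?c)"
      using delay eta speed_pos by (intro mult_left_mono add_right_mono) auto
    finally show ?thesis by (simp add: algebra_simps)
  qed
  have rest: "norm ((((b - a) * ?A + g \<bullet> (w a - u a)) / ?A) *\<^sub>R (wm - wp))
      \<le> \<eta> * (delay_const * (norm g + 1 + speed) + 1) * ?c / \<alpha> * speed"
  proof -
    have quot: "\<bar>((b - a) * ?A + g \<bullet> (w a - u a)) / ?A\<bar>
        \<le> \<eta> * (delay_const * (norm g + 1 + speed) + 1) * ?c / \<alpha>"
      unfolding abs_divide using lin rate_pos alpha_pos rate_before
      by (intro frac_le) auto
    moreover have "norm (wm - wp) \<le> speed" using jump_speed_le by (simp add: norm_minus_commute)
    ultimately show ?thesis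
      unfolding norm_scaleR by (intro mult_mono quot order_trans[OF abs_ge_zero quot]) auto
  qed
  have jump_c: "2 * \<eta> * (b - a) \<le> 2 * \<eta> * (delay_const * ?c)"
    using delay eta by (intro mult_left_mono) auto
  have quot_eq: "((b - a) * ?A + g \<bullet> (w a - u a)) / ?A = (b - a) + (g \<bullet> (w a - u a)) / ?A"
    using rate_pos by (simp add: add_divide_distrib)
  \<comment> \<open>The change between the crossings splits into a velocity error and the delay error.\<close>
  have decomp: "(w b - u b) - S (w a - u a)
      = ((w b - u b) - (w a - u a) - (b - a) *\<^sub>R (wm - wp))
        + (((b - a) * ?A + g \<bullet> (w a - u a)) / ?A) *\<^sub>R (wm - wp)"
    unfolding quot_eq saltation_map_def by (simp add: algebra_simps)
  have "norm ((w b - u b) - S (w a - u a))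
      \<le> 2 * \<eta> * (delay_const * ?c) + \<eta> * (delay_const * (norm g + 1 + speed) + 1) * ?c / \<alpha> * speed"
    unfolding decomp using jump jump_c rest by (intro norm_triangle_le) linarith
  also have "\<dots> = \<eta> * jump_const * ?c" unfolding jump_error_def by (simp add: algebra_simps)
  finally show "norm ((w b - u b) - S (w a - u a)) \<le> \<eta> * jump_const * ?c" .
qed

text \<open>
  Outside the interval between the two crossings the difference of the curves changes by a factor close
  to one, because \<open>L (t - s)\<close> is small.
\<close>

lemma ordered_crossings_estimate:
  assumes u: "curve_in_box s t u" "h a (u a) = 0" and w: "curve_in_box s t w" "h b (w b) = 0"
    and ab: "s \<le> a" "a \<le> b" "b \<le> t" and short: "2 * L * (t - s) \<le> \<eta>"
  shows "norm ((w t - u t) - S (w s - u s)) \<le> \<eta> * saltation_error wm wp g \<alpha> * norm (w s - u s)"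
proof -
  let ?d = "\<lambda>q. w q - u q"
  have u': "curve_in_box s a u" "curve_in_box a b u" "curve_in_box b t u"
    using ab by (auto intro: curve_in_box_mono[OF u(1)])
  have w': "curve_in_box s a w" "curve_in_box a b w" "curve_in_box b t w"
    using ab by (auto intro: curve_in_box_mono[OF w(1)])
  have short': "2 * L * (q - r) \<le> \<eta>" "L * (q - r) \<le> 1 / 2" if "s \<le> r" "q \<le> t" for q r
  proof -
    have "2 * L * (q - r) \<le> 2 * L * (t - s)"
      using that L_nonneg by (intro mult_left_mono) auto
    with short show "2 * L * (q - r) \<le> \<eta>" by simp
    with eta show "L * (q - r) \<le> 1 / 2" by simp
  qed
  have "h a (w a) \<le> 0"
    using level_strict_mono[OF w(1) ab(1), of b] w(2) ab by (cases "a = b") auto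
  then have "norm (?d a - ?d s) \<le> 2 * L * (a - s) * norm (?d s)"
    using u(2) ab short'(2)[of s a] by (intro deviation_before u' w') auto
  also have "\<dots> \<le> \<eta> * norm (?d s)"
    using short'(1)[of s a] ab by (intro mult_right_mono) auto
  finally have before: "norm (?d a - ?d s) \<le> \<eta> * norm (?d s)" .
  moreover have "\<eta> * norm (?d s) \<le> 1 * norm (?d s)" using eta by (intro mult_right_mono) auto
  ultimately have da: "norm (?d a) \<le> 2 * norm (?d s)"
    using norm_triangle_ineq2[of "?d a" "?d s"] by linarith
  note jump = crossing_jump[OF u'(2) u(2) w'(2) w(2) ab(2)]
  have "0 \<le> h b (u b)"
    using level_strict_mono[OF u(1) ab(1), of b] u(2) ab by (cases "a = b") auto
  then have "norm (?d t - ?d b) \<le> 2 * L * (t - b) * norm (?d b)"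
    using w(2) ab short'(2)[of b t] by (intro deviation_after u' w') auto
  also have "\<dots> \<le> \<eta> * norm (?d b)"
    using short'(1)[of b t] ab by (intro mult_right_mono) auto
  also have "\<dots> \<le> \<eta> * ((1 + 2 * speed * delay_const) * norm (?d a))"
    using jump(2) eta by (intro mult_left_mono) auto
  finally have after: "norm (?d t - ?d b) \<le> \<eta> * ((1 + 2 * speed * delay_const) * norm (?d a))" .
  have "norm (?d t - S (?d a)) \<le> \<eta> * (jump_const + 1 + 2 * speed * delay_const) * norm (?d a)"
    using after jump(1) norm_triangle_ineq[of "?d t - ?d b" "?d b - S (?d a)"]
    by (simp add: algebra_simps)
  also have "\<dots> \<le> \<eta> * (jump_const + 1 + 2 * speed * delay_const) * (2 * norm (?d s))"
  proof (intro mult_left_mono da)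
    have "0 \<le> jump_const"
      unfolding jump_error_def using delay_const_pos speed_pos alpha_pos by auto
    then show "0 \<le> \<eta> * (jump_const + 1 + 2 * speed * delay_const)"
      using eta delay_const_pos speed_pos by auto
  qed
  finally have main: "norm (?d t - S (?d a))
    \<le> \<eta> * (jump_const + 1 + 2 * speed * delay_const) * (2 * norm (?d s))" .
  have "norm (S (?d a) - S (?d s)) \<le> (1 + norm g * speed / \<alpha>) * norm (?d a - ?d s)"
    using saltation_map_bound[of "?d a - ?d s"] by (simp add: saltation_map_diff)
  also have "\<dots> \<le> (1 + norm g * speed / \<alpha>) * (\<eta> * norm (?d s))"
    using before alpha_pos speed_pos by (intro mult_left_mono) auto
  finally have "norm (?d t - S (?d s))
    \<le> \<eta> * (jump_const + 1 + 2 * speed * delay_const) * (2 * norm (?d s))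
      + (1 + norm g * speed / \<alpha>) * (\<eta> * norm (?d s))"
    using main norm_triangle_ineq[of "?d t - S (?d a)" "S (?d a) - S (?d s)"] by simp
  also have "\<dots> = \<eta> * saltation_error wm wp g \<alpha> * norm (?d s)"
    unfolding saltation_error_def by (simp add: algebra_simps)
  finally show ?thesis .
qed

text \<open>
  Exchanging the two curves changes the sign of both differences, and the saltation map is linear; so
  the case where \<open>w\<close> crosses first follows from the other one.
\<close>

lemma crossings_estimate:
  assumes u: "curve_in_box s t u" "a \<in> {s..t}" "h a (u a) = 0"
    and w: "curve_in_box s t w" "b \<in> {s..t}" "h b (w b) = 0"
    and short: "2 * L * (t - s) \<le> \<eta>"
  shows "norm ((w t - u t) - S (w s - u s)) \<le> \<eta> * saltation_error wm wp g \<alpha> * norm (w s - u s)"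
proof (cases "a \<le> b")
  case True
  then show ?thesis using ordered_crossings_estimate[OF u(1,3) w(1,3)] u w short by simp
next
  case False
  then have "norm ((u t - w t) - S (u s - w s)) \<le> \<eta> * saltation_error wm wp g \<alpha> * norm (u s - w s)"
    using ordered_crossings_estimate[OF w(1,3) u(1,3)] u w short by simp
  moreover have "(u t - w t) - S (u s - w s) = - ((w t - u t) - S (w s - u s))"
    by (simp add: saltation_map_diff)
  ultimately show ?thesis by (simp only: norm_minus_cancel norm_minus_commute[of "u s"])
qed

end

section \<open>Perturbations of a transversally crossing curve\<close>

text \<open>
  The regularity near a point of the boundary from which arbitrarily accurate boxes are obtained. The
  level function \<open>h\<close> is oriented so that it increases in the direction of crossing.
\<close>

locale switching_point =
  fixes N :: "(real \<times> 'a::euclidean_space) set"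
    and v vm vp :: "real \<Rightarrow> 'a \<Rightarrow> 'a"
    and h :: "real \<Rightarrow> 'a \<Rightarrow> real"
    and t1 ht L :: real and x1 g :: 'a
  assumes N_open: "open N" and point_in: "(t1, x1) \<in> N" and on_boundary: "h t1 x1 = 0"
    and h_C1: "C1_on (\<lambda>(t, x). h t x) N"
    and h_deriv: "((\<lambda>(t, x). h t x) has_derivative (\<lambda>(r, x). ht * r + g \<bullet> x)) (at (t1, x1))"
    and vm_cont: "continuous_on {(t, x) \<in> N. h t x \<le> 0} (\<lambda>(t, x). vm t x)"
    and vp_cont: "continuous_on {(t, x) \<in> N. 0 \<le> h t x} (\<lambda>(t, x). vp t x)"
    and vm_lipschitz: "\<And>t. L-lipschitz_on {x. (t, x) \<in> N \<and> h t x \<le> 0} (vm t)"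
    and vp_lipschitz: "\<And>t. L-lipschitz_on {x. (t, x) \<in> N \<and> 0 \<le> h t x} (vp t)"
    and v_sides: "\<And>t x. (t, x) \<in> N \<Longrightarrow> h t x < 0 \<Longrightarrow> v t x = vm t x"
      "\<And>t x. (t, x) \<in> N \<Longrightarrow> 0 < h t x \<Longrightarrow> v t x = vp t x"
      "\<And>t x. (t, x) \<in> N \<Longrightarrow> h t x = 0 \<Longrightarrow> v t x \<in> closed_segment (vm t x) (vp t x)"
begin

abbreviation wm :: 'a where "wm \<equiv> vm t1 x1"
abbreviation wp :: 'a where "wp \<equiv> vp t1 x1"

lemma L_nonneg: "0 \<le> L"
  using vm_lipschitz lipschitz_on_nonneg by blast

lemma h_continuous: "continuous_on N (\<lambda>(t, x). h t x)"
proof -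
  obtain f' where "\<And>p. p \<in> N \<Longrightarrow> ((\<lambda>(t, x). h t x) has_derivative blinfun_apply (f' p)) (at p)"
    using h_C1 unfolding C1_on_def by blast
  then show ?thesis
    by (intro has_derivative_continuous_on[of N _ "\<lambda>p. blinfun_apply (f' p)"])
      (rule has_derivative_at_withinI)
qed

text \<open>
  The mean value theorem on a ball, with the derivative at the centre as reference: its error is
  controlled for any two points of the ball, as needed to compare points of two different curves.
\<close>

lemma level_remainder:
  assumes "0 < \<eta>"
  obtains \<delta> where "0 < \<delta>" "ball (t1, x1) \<delta> \<subseteq> N"
    "\<And>t x r y. (t, x) \<in> ball (t1, x1) \<delta> \<Longrightarrow> (r, y) \<in> ball (t1, x1) \<delta> \<Longrightarrow>
       \<bar>h t x - h r y - (ht * (t - r) + g \<bullet> (x - y))\<bar> \<le> \<eta> * (\<bar>t - r\<bar> + norm (x - y))"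
proof -
  let ?p = "(t1, x1)"
  obtain f' :: "real \<times> 'a \<Rightarrow> (real \<times> 'a) \<Rightarrow>\<^sub>L real" where
    f': "\<And>p. p \<in> N \<Longrightarrow> ((\<lambda>(t, x). h t x) has_derivative blinfun_apply (f' p)) (at p)"
    and cont: "continuous_on N f'"
    using h_C1 unfolding C1_on_def by blast
  have f'_p: "blinfun_apply (f' ?p) = (\<lambda>(r, x). ht * r + g \<bullet> x)"
    using has_derivative_unique[OF f'[OF point_in] h_deriv] .
  obtain \<delta>1 where \<delta>1: "0 < \<delta>1" "\<And>p. p \<in> N \<Longrightarrow> dist p ?p < \<delta>1 \<Longrightarrow> dist (f' p) (f' ?p) < \<eta>"
    using cont point_in assms unfolding continuous_on_iff by blast
  obtain \<delta>2 where \<delta>2: "0 < \<delta>2" "ball ?p \<delta>2 \<subseteq> N"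
    using N_open point_in openE by blast
  define \<delta> where "\<delta> = min \<delta>1 \<delta>2"
  have ball: "ball ?p \<delta> \<subseteq> N" "0 < \<delta>" using \<delta>1(1) \<delta>2 unfolding \<delta>_def by auto
  have "\<bar>h t x - h r y - (ht * (t - r) + g \<bullet> (x - y))\<bar> \<le> \<eta> * (\<bar>t - r\<bar> + norm (x - y))"
    if p: "(t, x) \<in> ball ?p \<delta>" and q: "(r, y) \<in> ball ?p \<delta>" for t x r y
  proof -
    have "norm ((\<lambda>(t, x). h t x) (t, x) - (\<lambda>(t, x). h t x) (r, y) - blinfun_apply (f' ?p) ((t, x) - (r, y)))
        \<le> norm ((t, x) - (r, y)) * \<eta>"
    proof (rule differentiable_bound_linearization[where S = "ball ?p \<delta>" and f' = "\<lambda>p. blinfun_apply (f' p)"])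
      show "(r, y) + s *\<^sub>R ((t, x) - (r, y)) \<in> ball ?p \<delta>" if "s \<in> {0..1}" for s
        using convexD[OF convex_ball[of ?p \<delta>] q p, of "1 - s" s] that
        by (simp only: algebra_simps) auto
      show "((\<lambda>(t, x). h t x) has_derivative blinfun_apply (f' z)) (at z within ball ?p \<delta>)"
        if "z \<in> ball ?p \<delta>" for z
        using f' ball that has_derivative_at_withinI by blast
      show "onorm (blinfun_apply (f' z) - blinfun_apply (f' ?p)) \<le> \<eta>" if "z \<in> ball ?p \<delta>" for z
      proof -
        have "dist z ?p < \<delta>1" "z \<in> N" using that ball by (auto simp: \<delta>_def dist_commute)
        then have "norm (f' z - f' ?p) \<le> \<eta>" using \<delta>1(2)[of z] by (simp add: dist_norm)
        then show ?thesis by (simp add: norm_blinfun.rep_eq minus_blinfun.rep_eq fun_diff_def)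
      qed
      show "?p \<in> ball ?p \<delta>" using ball by simp
    qed
    also have "\<dots> \<le> (\<bar>t - r\<bar> + norm (x - y)) * \<eta>"
      using norm_Pair_le[of "t - r" "x - y"] assms by (intro mult_right_mono) auto
    finally show ?thesis by (simp add: f'_p mult.commute)
  qed
  with that ball show thesis by blast
qed

lemma exists_switching_box:
  assumes "0 < \<eta>" "\<eta> \<le> 1"
  obtains \<rho> where "0 < \<rho>" "ball t1 \<rho> \<times> ball x1 \<rho> \<subseteq> N"
    "switching_box (ball t1 \<rho> \<times> ball x1 \<rho>) v vm vp h wm wp g ht L \<eta>"
proof -
  let ?p = "(t1, x1)"
  obtain \<delta>1 where \<delta>1: "0 < \<delta>1" "ball ?p \<delta>1 \<subseteq> N"
    "\<And>t x r y. (t, x) \<in> ball ?p \<delta>1 \<Longrightarrow> (r, y) \<in> ball ?p \<delta>1 \<Longrightarrow>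
       \<bar>h t x - h r y - (ht * (t - r) + g \<bullet> (x - y))\<bar> \<le> \<eta> * (\<bar>t - r\<bar> + norm (x - y))"
    using level_remainder[OF assms(1)] by metis
  have mem: "?p \<in> {(t, x) \<in> N. h t x \<le> 0}" "?p \<in> {(t, x) \<in> N. 0 \<le> h t x}"
    using point_in on_boundary by auto
  obtain \<delta>2 where \<delta>2: "0 < \<delta>2"
    "\<forall>p\<in>{(t, x) \<in> N. h t x \<le> 0}. dist p ?p < \<delta>2 \<longrightarrow>
       dist ((\<lambda>(t, x). vm t x) p) ((\<lambda>(t, x). vm t x) ?p) < \<eta>"
    using vm_cont mem(1) assms(1) unfolding continuous_on_iff by blast
  obtain \<delta>3 where \<delta>3: "0 < \<delta>3"
    "\<forall>p\<in>{(t, x) \<in> N. 0 \<le> h t x}. dist p ?p < \<delta>3 \<longrightarrow>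
       dist ((\<lambda>(t, x). vp t x) p) ((\<lambda>(t, x). vp t x) ?p) < \<eta>"
    using vp_cont mem(2) assms(1) unfolding continuous_on_iff by blast
  define \<rho> where "\<rho> = min \<delta>1 (min \<delta>2 \<delta>3) / 2"
  have \<rho>: "0 < \<rho>" using \<delta>1(1) \<delta>2(1) \<delta>3(1) unfolding \<rho>_def by simp
  have near: "dist (t, x) ?p < \<delta>1" "dist (t, x) ?p < \<delta>2" "dist (t, x) ?p < \<delta>3" "(t, x) \<in> N"
    if "(t, x) \<in> ball t1 \<rho> \<times> ball x1 \<rho>" for t x
  proof -
    have "dist (t, x) ?p \<le> dist t t1 + dist x x1"
      unfolding dist_Pair_Pair by (rule sqrt_sum_squares_le_sum) auto
    also have "\<dots> < 2 * \<rho>" using that by (simp add: dist_commute)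
    finally show "dist (t, x) ?p < \<delta>1" "dist (t, x) ?p < \<delta>2" "dist (t, x) ?p < \<delta>3"
      unfolding \<rho>_def by auto
    then show "(t, x) \<in> N" using \<delta>1(2) by (auto simp: dist_commute)
  qed
  have "switching_box (ball t1 \<rho> \<times> ball x1 \<rho>) v vm vp h wm wp g ht L \<eta>"
  proof
    fix t x assume tx: "(t, x) \<in> ball t1 \<rho> \<times> ball x1 \<rho>"
    note n = near[OF tx]
    show "norm (vm t x - wm) \<le> \<eta>" if "h t x \<le> 0"
      using \<delta>2(2)[rule_format, of "(t, x)"] n that by (simp add: dist_norm)
    show "norm (vp t x - wp) \<le> \<eta>" if "0 \<le> h t x"
      using \<delta>3(2)[rule_format, of "(t, x)"] n that by (simp add: dist_norm)
    show "h t x < 0 \<Longrightarrow> v t x = vm t x" "0 < h t x \<Longrightarrow> v t x = vp t x"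
      "h t x = 0 \<Longrightarrow> v t x \<in> closed_segment (vm t x) (vp t x)"
      using v_sides n by auto
    fix y assume ty: "(t, y) \<in> ball t1 \<rho> \<times> ball x1 \<rho>"
    show "norm (vm t x - vm t y) \<le> L * norm (x - y)" if "h t x \<le> 0" "h t y \<le> 0"
      using that n near[OF ty] by (intro lipschitz_on_normD[OF vm_lipschitz[of t]]) auto
    show "norm (vp t x - vp t y) \<le> L * norm (x - y)" if "0 \<le> h t x" "0 \<le> h t y"
      using that n near[OF ty] by (intro lipschitz_on_normD[OF vp_lipschitz[of t]]) auto
  next
    fix t x r y
    assume "(t, x) \<in> ball t1 \<rho> \<times> ball x1 \<rho>" "(r, y) \<in> ball t1 \<rho> \<times> ball x1 \<rho>"
    then have "(t, x) \<in> ball ?p \<delta>1" "(r, y) \<in> ball ?p \<delta>1"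
      using near(1) unfolding mem_ball dist_commute[of ?p] by blast+
    then show "\<bar>h t x - h r y - (ht * (t - r) + g \<bullet> (x - y))\<bar> \<le> \<eta> * (\<bar>t - r\<bar> + norm (x - y))"
      by (rule \<delta>1(3))
  qed (use L_nonneg assms in auto)
  moreover have "ball t1 \<rho> \<times> ball x1 \<rho> \<subseteq> N" using near(4) by auto
  ultimately show thesis using that \<rho> by blast
qed

end

locale crossing_curve = switching_point +
  fixes a0 b0 :: real and u :: "real \<Rightarrow> 'a"
  assumes interior: "a0 < t1" "t1 < b0"
    and curve: "integral_curve_on v {a0..b0} u"
    and hits: "u t1 = x1"
    and approaches: "\<forall>\<^sub>F t in at_left t1. h t (u t) < 0"
    and departs: "\<forall>\<^sub>F t in at_right t1. 0 < h t (u t)"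
begin

lemma curve_near_point:
  assumes "0 < \<rho>"
  obtains \<epsilon> where "0 < \<epsilon>" "\<And>q. \<bar>q - t1\<bar> < \<epsilon> \<Longrightarrow> q \<in> {a0..b0} \<and> u q \<in> ball x1 \<rho>"
proof -
  have "continuous (at t1) u"
    using integral_curve_on_continuous[OF curve] interior
    by (intro continuous_on_interior[of "{a0..b0}"]) auto
  then obtain \<epsilon> where \<epsilon>: "0 < \<epsilon>" "\<And>q. dist q t1 < \<epsilon> \<Longrightarrow> dist (u q) (u t1) < \<rho>"
    using assms unfolding continuous_at_eps_delta by (metis dist_norm real_norm_def)
  have "q \<in> {a0..b0} \<and> u q \<in> ball x1 \<rho>" if "\<bar>q - t1\<bar> < min \<epsilon> (min (t1 - a0) (b0 - t1))" for q
    using \<epsilon>(2)[of q] that hits by (auto simp: dist_norm norm_minus_commute)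
  with that[of "min \<epsilon> (min (t1 - a0) (b0 - t1))"] \<epsilon>(1) interior show thesis by simp
qed

lemma curve_in_box_near:
  assumes box: "switching_box (ball t1 \<rho> \<times> ball x1 \<rho>) v vm vp h wm wp g ht L \<eta>" and \<rho>: "0 < \<rho>"
  obtains \<epsilon> where "0 < \<epsilon>"
    "\<And>s t. \<bar>s - t1\<bar> < \<epsilon> \<Longrightarrow> \<bar>t - t1\<bar> < \<epsilon> \<Longrightarrow>
       switching_box.curve_in_box (ball t1 \<rho> \<times> ball x1 \<rho>) v s t u"
proof -
  interpret switching_box "ball t1 \<rho> \<times> ball x1 \<rho>" v vm vp h wm wp g ht L \<eta> by (rule box)
  obtain \<epsilon> where \<epsilon>: "0 < \<epsilon>" "\<And>q. \<bar>q - t1\<bar> < \<epsilon> \<Longrightarrow> q \<in> {a0..b0} \<and> u q \<in> ball x1 \<rho>"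
    using curve_near_point[OF \<rho>] by blast
  have "curve_in_box s t u" if "\<bar>s - t1\<bar> < min \<epsilon> \<rho>" "\<bar>t - t1\<bar> < min \<epsilon> \<rho>" for s t
  proof -
    have q: "\<bar>q - t1\<bar> < min \<epsilon> \<rho>" if "q \<in> {s..t}" for q
      using that \<open>\<bar>s - t1\<bar> < min \<epsilon> \<rho>\<close> \<open>\<bar>t - t1\<bar> < min \<epsilon> \<rho>\<close> by auto
    have "{s..t} \<subseteq> {a0..b0}" using \<epsilon>(2) q by auto
    then show ?thesis
      unfolding curve_in_box_def using integral_curve_on_subset[OF curve] \<epsilon>(2) q
      by (auto simp: dist_real_def abs_minus_commute)
  qed
  with that[of "min \<epsilon> \<rho>"] \<epsilon>(1) \<rho> show thesis by simp
qed

text \<open>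
  The level along the reference curve is negative before the hitting time, zero at it and positive
  afterwards; in boxes with smaller and smaller \<open>\<eta>\<close> this leaves no room for a negative rate.
\<close>

lemma rates_nonneg:
  shows "0 \<le> ht + g \<bullet> wm" and "0 \<le> ht + g \<bullet> wp"
proof -
  let ?K = "norm g + 1 + speed_bound wm wp"
  have K: "0 < ?K" unfolding speed_bound_def by (simp add: add_pos_nonneg)
  have *: "- (\<eta> * ?K) \<le> ht + g \<bullet> wm \<and> - (\<eta> * ?K) \<le> ht + g \<bullet> wp" if \<eta>: "0 < \<eta>" "\<eta> \<le> 1" for \<eta>
  proof -
    obtain \<rho> where \<rho>: "0 < \<rho>" "switching_box (ball t1 \<rho> \<times> ball x1 \<rho>) v vm vp h wm wp g ht L \<eta>"
      using exists_switching_box[OF \<eta>] by blast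
    interpret switching_box "ball t1 \<rho> \<times> ball x1 \<rho>" v vm vp h wm wp g ht L \<eta> by (rule \<rho>(2))
    obtain \<epsilon> where \<epsilon>: "0 < \<epsilon>"
      "\<And>s t. \<bar>s - t1\<bar> < \<epsilon> \<Longrightarrow> \<bar>t - t1\<bar> < \<epsilon> \<Longrightarrow> curve_in_box s t u"
      using curve_in_box_near[OF \<rho>(2,1)] by blast
    obtain l where l: "l < t1" "\<And>q. l < q \<Longrightarrow> q < t1 \<Longrightarrow> h q (u q) < 0"
      using approaches unfolding eventually_at_left_field by blast
    obtain r where r: "t1 < r" "\<And>q. t1 < q \<Longrightarrow> q < r \<Longrightarrow> 0 < h q (u q)"
      using departs unfolding eventually_at_right_field by blast
    define s where "s = max ((l + t1) / 2) (t1 - \<epsilon> / 2)"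
    define t where "t = min ((r + t1) / 2) (t1 + \<epsilon> / 2)"
    have s: "s < t1" "l < s" "\<bar>s - t1\<bar> < \<epsilon>" using l(1) \<epsilon>(1) unfolding s_def by (auto simp: max_def abs_if field_simps)
    have t: "t1 < t" "t < r" "\<bar>t - t1\<bar> < \<epsilon>" using r(1) \<epsilon>(1) unfolding t_def by (auto simp: min_def abs_if field_simps)
    show ?thesis
      using approach_rate_lower_bound[of s t1 u] departure_rate_lower_bound[of t1 t u]
        \<epsilon>(2)[of s t1] \<epsilon>(2)[of t1 t] \<epsilon>(1) s t l(2) r(2) on_boundary hits by auto
  qed
  have small: "0 \<le> A" if A: "\<And>\<eta>. 0 < \<eta> \<Longrightarrow> \<eta> \<le> 1 \<Longrightarrow> - (\<eta> * ?K) \<le> A" for A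
  proof (rule field_le_epsilon)
    fix e :: real assume "0 < e"
    have "min 1 (e / ?K) * ?K \<le> e / ?K * ?K" using K by (intro mult_right_mono) auto
    then have "min 1 (e / ?K) * ?K \<le> e" using K by simp
    moreover have "- (min 1 (e / ?K) * ?K) \<le> A" using K \<open>0 < e\<close> by (intro A) auto
    ultimately show "0 \<le> A + e" by linarith
  qed
  show "0 \<le> ht + g \<bullet> wm" and "0 \<le> ht + g \<bullet> wp" by (rule small; use * in blast)+
qed

text \<open>
  The times \<open>s\<close> and \<open>t\<close> may be chosen before the perturbation: whether a curve stays in the box is decided
  by its position at time \<open>s\<close> and the speed bound alone.
\<close>

lemma nearby_curve_in_box:
  assumes box: "switching_box (ball t1 \<rho> \<times> ball x1 \<rho>) v vm vp h wm wp g ht L \<eta>" and \<rho>: "0 < \<rho>"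
  obtains \<epsilon> where "0 < \<epsilon>"
    "\<And>s t. \<bar>s - t1\<bar> < \<epsilon> \<Longrightarrow> \<bar>t - t1\<bar> < \<epsilon> \<Longrightarrow>
       switching_box.curve_in_box (ball t1 \<rho> \<times> ball x1 \<rho>) v s t u"
    "\<And>s t w. \<bar>s - t1\<bar> < \<epsilon> \<Longrightarrow> \<bar>t - t1\<bar> < \<epsilon> \<Longrightarrow> norm (w s - u s) < \<epsilon> \<Longrightarrow>
       integral_curve_on v {s..t} w \<Longrightarrow>
       switching_box.curve_in_box (ball t1 \<rho> \<times> ball x1 \<rho>) v s t w"
proof -
  interpret switching_box "ball t1 \<rho> \<times> ball x1 \<rho>" v vm vp h wm wp g ht L \<eta> by (rule box)
  obtain \<epsilon>1 where \<epsilon>1: "0 < \<epsilon>1"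
    "\<And>s t. \<bar>s - t1\<bar> < \<epsilon>1 \<Longrightarrow> \<bar>t - t1\<bar> < \<epsilon>1 \<Longrightarrow> curve_in_box s t u"
    using curve_in_box_near[OF box \<rho>] by blast
  obtain \<epsilon>2 where \<epsilon>2: "0 < \<epsilon>2" "\<And>q. \<bar>q - t1\<bar> < \<epsilon>2 \<Longrightarrow> q \<in> {a0..b0} \<and> u q \<in> ball x1 (\<rho> / 4)"
    using curve_near_point[of "\<rho> / 4"] \<rho> by auto
  define \<epsilon> where "\<epsilon> = min (min \<epsilon>1 \<epsilon>2) (min (\<rho> / 4) (\<rho> / (8 * speed)))"
  have \<epsilon>: "0 < \<epsilon>" "\<epsilon> \<le> \<epsilon>1" "\<epsilon> \<le> \<epsilon>2" "\<epsilon> \<le> \<rho> / 4" "\<epsilon> \<le> \<rho> / (8 * speed)"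
    using \<epsilon>1(1) \<epsilon>2(1) \<rho> speed_pos unfolding \<epsilon>_def by auto
  have "curve_in_box s t w"
    if st: "\<bar>s - t1\<bar> < \<epsilon>" "\<bar>t - t1\<bar> < \<epsilon>" and start: "norm (w s - u s) < \<epsilon>"
      and w: "integral_curve_on v {s..t} w" for s t w
  proof -
    have q: "q \<in> ball t1 \<rho>" if "q \<in> {s..t}" for q
      using that st \<epsilon>(4) \<rho> by (auto simp: dist_real_def abs_less_iff)
    have "norm (w s - x1) \<le> norm (w s - u s) + norm (u s - x1)"
      using norm_triangle_ineq[of "w s - u s" "u s - x1"] by simp
    also have "\<dots> < \<rho> / 4 + \<rho> / 4"
      using start \<epsilon>(3,4) \<epsilon>2(2)[of s] st(1) by (auto simp: dist_norm norm_minus_commute)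
    finally have "norm (w s - x1) < \<rho> / 2" by simp
    moreover have "speed * (t - s) \<le> speed * (2 * \<epsilon>)"
      using st speed_pos by (intro mult_left_mono) auto
    moreover have "speed * (2 * \<epsilon>) \<le> \<rho> / 4"
      using \<epsilon>(5) speed_pos by (simp add: field_simps)
    ultimately have "norm (w s - x1) + speed * (t - s) < \<rho>" using \<rho> by linarith
    then have "w r \<in> ball x1 \<rho>" if "r \<in> {s..t}" for r
      using that q velocity_le_speed speed_pos
      by (intro integral_curve_stays_in_ball[OF w, where V = speed]) auto
    then show ?thesis unfolding curve_in_box_def using w q by auto
  qed
  with that[of \<epsilon>] \<epsilon> \<epsilon>1(2) show thesis by force
qed

end

locale transversal_crossing_curve = crossing_curve +
  assumes transversal: "ht + g \<bullet> wm \<noteq> 0" "ht + g \<bullet> wp \<noteq> 0"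
begin

lemma exists_transversal_box:
  assumes "0 < \<kappa>"
  obtains \<rho> \<eta> \<alpha> where "0 < \<rho>" "ball t1 \<rho> \<times> ball x1 \<rho> \<subseteq> N"
    "transversal_box (ball t1 \<rho> \<times> ball x1 \<rho>) v vm vp h wm wp g ht L \<eta> \<alpha>"
    "\<eta> * saltation_error wm wp g \<alpha> \<le> \<kappa>"
proof -
  define \<alpha> where "\<alpha> = min (ht + g \<bullet> wm) (ht + g \<bullet> wp)"
  have \<alpha>: "0 < \<alpha>" "\<alpha> \<le> ht + g \<bullet> wm" "\<alpha> \<le> ht + g \<bullet> wp"
    using rates_nonneg transversal unfolding \<alpha>_def by auto
  define C where "C = \<bar>saltation_error wm wp g \<alpha>\<bar> + 1"
  define K where "K = norm g + 1 + speed_bound wm wp"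
  have C: "0 < C" "saltation_error wm wp g \<alpha> \<le> C" unfolding C_def by auto
  have K: "0 < K" unfolding K_def speed_bound_def by (simp add: add_pos_nonneg)
  define \<eta> where "\<eta> = min 1 (min (\<kappa> / C) (\<alpha> / (2 * K)))"
  have \<eta>: "0 < \<eta>" "\<eta> \<le> 1" "\<eta> \<le> \<kappa> / C" "\<eta> \<le> \<alpha> / (2 * K)"
    using assms C(1) K \<alpha>(1) unfolding \<eta>_def by auto
  obtain \<rho> where \<rho>: "0 < \<rho>" "ball t1 \<rho> \<times> ball x1 \<rho> \<subseteq> N"
    "switching_box (ball t1 \<rho> \<times> ball x1 \<rho>) v vm vp h wm wp g ht L \<eta>"
    using exists_switching_box[OF \<eta>(1,2)] by blast
  have "\<eta> * K \<le> \<alpha> / 2" using \<eta>(4) K by (simp add: field_simps)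
  then have "transversal_box (ball t1 \<rho> \<times> ball x1 \<rho>) v vm vp h wm wp g ht L \<eta> \<alpha>"
    using \<rho>(3) \<alpha> unfolding transversal_box_def transversal_box_axioms_def K_def by simp
  moreover have "\<eta> * saltation_error wm wp g \<alpha> \<le> \<eta> * C" using C \<eta>(1) by (intro mult_left_mono) auto
  moreover have "\<eta> * C \<le> \<kappa>" using \<eta>(3) C(1) by (simp add: field_simps)
  ultimately show thesis using that \<rho>(1,2) by fastforce
qed

text \<open>
  A neighbour of the reference curve at time \<open>t\<close> is on the incoming side, as the reference curve is.
  Hence two perturbations separate by a factor \<open>1 + O(t - s)\<close> only.
\<close>

lemma deviation_before_hitting:
  obtains \<epsilon> where "0 < \<epsilon>"
    "\<And>s t. t1 - \<epsilon> < s \<Longrightarrow> s \<le> t \<Longrightarrow> t < t1 \<Longrightarrow>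
       \<exists>\<delta>>0. \<forall>w. integral_curve_on v {s..t} w \<and> norm (w s - u s) < \<delta> \<and> norm (w t - u t) < \<delta> \<longrightarrow>
         norm ((w t - u t) - (w s - u s)) \<le> 2 * L * (t - s) * norm (w s - u s)"
    "L * \<epsilon> \<le> 1 / 2"
proof -
  obtain \<rho> \<eta> \<alpha> where \<rho>: "0 < \<rho>"
    and box: "transversal_box (ball t1 \<rho> \<times> ball x1 \<rho>) v vm vp h wm wp g ht L \<eta> \<alpha>"
    using exists_transversal_box[of 1] by (metis zero_less_one)
  interpret transversal_box "ball t1 \<rho> \<times> ball x1 \<rho>" v vm vp h wm wp g ht L \<eta> \<alpha> by (rule box)
  obtain \<epsilon>1 where \<epsilon>1: "0 < \<epsilon>1"
    "\<And>s t. \<bar>s - t1\<bar> < \<epsilon>1 \<Longrightarrow> \<bar>t - t1\<bar> < \<epsilon>1 \<Longrightarrow> curve_in_box s t u"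
    "\<And>s t w. \<bar>s - t1\<bar> < \<epsilon>1 \<Longrightarrow> \<bar>t - t1\<bar> < \<epsilon>1 \<Longrightarrow> norm (w s - u s) < \<epsilon>1 \<Longrightarrow>
       integral_curve_on v {s..t} w \<Longrightarrow> curve_in_box s t w"
    using nearby_curve_in_box[OF switching_box_axioms \<rho>] by blast
  define \<epsilon> where "\<epsilon> = min \<epsilon>1 (1 / (2 * (L + 1)))"
  have \<epsilon>: "0 < \<epsilon>" "\<epsilon> \<le> \<epsilon>1" using \<epsilon>1(1) L_nonneg unfolding \<epsilon>_def by auto
  have "L * \<epsilon> \<le> L * (1 / (2 * (L + 1)))"
    using L_nonneg unfolding \<epsilon>_def by (intro mult_left_mono) auto
  also have "\<dots> \<le> 1 / 2" using L_nonneg by (simp add: field_simps)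
  finally have L\<epsilon>: "L * \<epsilon> \<le> 1 / 2" .
  have "\<exists>\<delta>>0. \<forall>w. integral_curve_on v {s..t} w \<and> norm (w s - u s) < \<delta> \<and> norm (w t - u t) < \<delta> \<longrightarrow>
         norm ((w t - u t) - (w s - u s)) \<le> 2 * L * (t - s) * norm (w s - u s)"
    if st: "t1 - \<epsilon> < s" "s \<le> t" "t < t1" for s t
  proof -
    have near: "\<bar>s - t1\<bar> < \<epsilon>1" "\<bar>t - t1\<bar> < \<epsilon>1" "\<bar>t1 - t1\<bar> < \<epsilon>1" using st \<epsilon> by auto
    have "h t (u t) < 0"
      using level_strict_mono[OF \<epsilon>1(2)[OF near(1,3)], of t t1] st on_boundary hits by simp
    define \<delta> where "\<delta> = min \<epsilon>1 (- h t (u t) / (norm g + 1))"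
    have g: "0 < norm g + 1" by (simp add: add_nonneg_pos)
    have \<delta>: "0 < \<delta>" using \<epsilon>1(1) g \<open>h t (u t) < 0\<close> unfolding \<delta>_def by (simp add: divide_neg_pos)
    have "norm ((w t - u t) - (w s - u s)) \<le> 2 * L * (t - s) * norm (w s - u s)"
      if w: "integral_curve_on v {s..t} w" "norm (w s - u s) < \<delta>" "norm (w t - u t) < \<delta>" for w
    proof -
      have in_box: "curve_in_box s t u" "curve_in_box s t w"
        using \<epsilon>1(2)[OF near(1,2)] \<epsilon>1(3)[OF near(1,2) _ w(1)] w(2) unfolding \<delta>_def by auto
      have "norm (w t - u t) \<le> - h t (u t) / (norm g + 1)" using w(3) unfolding \<delta>_def by simp
      then have "(norm g + 1) * norm (w t - u t) \<le> - h t (u t)" using g by (simp add: field_simps)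
      then have "h t (w t) \<le> 0"
        using level_lipschitz[of t "w t" "u t"] curve_in_boxD(1)[OF in_box(1)]
          curve_in_boxD(1)[OF in_box(2)] st by (simp add: abs_le_iff)
      moreover have "L * (t - s) \<le> L * \<epsilon>" using st L_nonneg by (intro mult_left_mono) auto
      ultimately show ?thesis
        using \<open>h t (u t) < 0\<close> L\<epsilon> st by (intro deviation_before in_box) auto
    qed
    with \<delta> show ?thesis by blast
  qed
  with that \<epsilon>(1) L\<epsilon> show thesis by blast
qed

text \<open>
  Closeness at the two end times suffices for a perturbed curve to be on the incoming side at \<open>s\<close> and on
  the outgoing side at \<open>t\<close>; the intermediate value theorem yields its crossing time.
\<close>

lemma deviation_across_hitting:
  assumes "0 < \<kappa>"
  obtains \<epsilon> where "0 < \<epsilon>"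
    "\<And>s t. t1 - \<epsilon> < s \<Longrightarrow> s < t1 \<Longrightarrow> t1 < t \<Longrightarrow> t < t1 + \<epsilon> \<Longrightarrow>
       \<exists>\<delta>>0. \<forall>w. integral_curve_on v {s..t} w \<and> norm (w s - u s) < \<delta> \<and> norm (w t - u t) < \<delta> \<longrightarrow>
         norm ((w t - u t) - saltation_map wm wp g ht (w s - u s)) \<le> \<kappa> * norm (w s - u s)"
proof -
  obtain \<rho> \<eta> \<alpha> where \<rho>: "0 < \<rho>" "ball t1 \<rho> \<times> ball x1 \<rho> \<subseteq> N"
    and box: "transversal_box (ball t1 \<rho> \<times> ball x1 \<rho>) v vm vp h wm wp g ht L \<eta> \<alpha>"
    and \<eta>: "\<eta> * saltation_error wm wp g \<alpha> \<le> \<kappa>"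
    using exists_transversal_box[OF assms] by blast
  interpret transversal_box "ball t1 \<rho> \<times> ball x1 \<rho>" v vm vp h wm wp g ht L \<eta> \<alpha> by (rule box)
  obtain \<epsilon>1 where \<epsilon>1: "0 < \<epsilon>1"
    "\<And>s t. \<bar>s - t1\<bar> < \<epsilon>1 \<Longrightarrow> \<bar>t - t1\<bar> < \<epsilon>1 \<Longrightarrow> curve_in_box s t u"
    "\<And>s t w. \<bar>s - t1\<bar> < \<epsilon>1 \<Longrightarrow> \<bar>t - t1\<bar> < \<epsilon>1 \<Longrightarrow> norm (w s - u s) < \<epsilon>1 \<Longrightarrow>
       integral_curve_on v {s..t} w \<Longrightarrow> curve_in_box s t w"
    using nearby_curve_in_box[OF switching_box_axioms \<rho>(1)] by blast
  define \<epsilon> where "\<epsilon> = min \<epsilon>1 (\<eta> / (4 * (L + 1)))"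
  have \<epsilon>: "0 < \<epsilon>" "\<epsilon> \<le> \<epsilon>1" using \<epsilon>1(1) L_nonneg eta unfolding \<epsilon>_def by auto
  have "L * \<epsilon> \<le> L * (\<eta> / (4 * (L + 1)))"
    using L_nonneg unfolding \<epsilon>_def by (intro mult_left_mono) auto
  also have "\<dots> \<le> \<eta> / 4" using L_nonneg eta by (simp add: field_simps)
  finally have L\<epsilon>: "L * \<epsilon> \<le> \<eta> / 4" .
  have "\<exists>\<delta>>0. \<forall>w. integral_curve_on v {s..t} w \<and> norm (w s - u s) < \<delta> \<and> norm (w t - u t) < \<delta> \<longrightarrow>
         norm ((w t - u t) - saltation_map wm wp g ht (w s - u s)) \<le> \<kappa> * norm (w s - u s)"
    if st: "t1 - \<epsilon> < s" "s < t1" "t1 < t" "t < t1 + \<epsilon>" for s t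
  proof -
    have near: "\<bar>s - t1\<bar> < \<epsilon>1" "\<bar>t - t1\<bar> < \<epsilon>1" using st \<epsilon> by auto
    note u_box = \<epsilon>1(2)[OF near]
    have level: "h s (u s) < 0" "0 < h t (u t)"
      using level_strict_mono[OF u_box, of s t1] level_strict_mono[OF u_box, of t1 t]
        st on_boundary hits by auto
    have g: "0 < norm g + 1" by (simp add: add_nonneg_pos)
    define \<delta> where "\<delta> = min \<epsilon>1 (min (- h s (u s) / (norm g + 1)) (h t (u t) / (norm g + 1)))"
    have \<delta>: "0 < \<delta>" using \<epsilon>1(1) g level unfolding \<delta>_def by (simp add: divide_neg_pos)
    have "norm ((w t - u t) - saltation_map wm wp g ht (w s - u s)) \<le> \<kappa> * norm (w s - u s)"
      if w: "integral_curve_on v {s..t} w" "norm (w s - u s) < \<delta>" "norm (w t - u t) < \<delta>" for w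
    proof -
      have w_box: "curve_in_box s t w"
        using \<epsilon>1(3)[OF near _ w(1)] w(2) unfolding \<delta>_def by auto
      have "norm (w s - u s) \<le> - h s (u s) / (norm g + 1)"
        "norm (w t - u t) \<le> h t (u t) / (norm g + 1)" using w(2,3) unfolding \<delta>_def by auto
      then have "(norm g + 1) * norm (w s - u s) \<le> - h s (u s)"
        "(norm g + 1) * norm (w t - u t) \<le> h t (u t)" using g by (auto simp: field_simps)
      then have sides: "h s (w s) \<le> 0" "0 \<le> h t (w t)"
        using level_lipschitz[of t "w t" "u t"] level_lipschitz[of s "w s" "u s"]
          curve_in_boxD(1)[OF u_box, of t] curve_in_boxD(1)[OF w_box, of t]
          curve_in_boxD(1)[OF u_box, of s] curve_in_boxD(1)[OF w_box, of s] st by (auto simp: abs_le_iff)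
      have "continuous_on {s..t} (\<lambda>q. (\<lambda>(q, x). h q x) (q, w q))"
        using curve_in_boxD(1,3)[OF w_box] \<rho>(2)
        by (intro continuous_on_compose2[OF h_continuous] continuous_intros) auto
      then obtain b where b: "b \<in> {s..t}" "h b (w b) = 0"
        using IVT'[of "\<lambda>q. h q (w q)" s 0 t] sides st by auto
      have "2 * L * (t - s) \<le> 2 * L * (2 * \<epsilon>)" using st L_nonneg by (intro mult_left_mono) auto
      then have "2 * L * (t - s) \<le> \<eta>" using L\<epsilon> by simp
      then have "norm ((w t - u t) - saltation_map wm wp g ht (w s - u s))
          \<le> \<eta> * saltation_error wm wp g \<alpha> * norm (w s - u s)"
        using st hits on_boundary b by (intro crossings_estimate[OF u_box _ _ w_box, of t1 b]) auto
      also have "\<dots> \<le> \<kappa> * norm (w s - u s)" using \<eta> by (intro mult_right_mono) auto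
      finally show ?thesis .
    qed
    with \<delta> show ?thesis by blast
  qed
  with that \<epsilon>(1) show thesis by blast
qed

end

section \<open>From curves to fundamental matrices\<close>

lemma fundamental_matrix_imp_has_derivative:
  fixes \<phi> :: "real \<Rightarrow> real ^ 'd \<Rightarrow> real ^ 'd"
  assumes "fundamental_matrix \<phi> t x D"
  shows "(\<phi> t has_derivative (*v) D) (at x)"
proof -
  obtain C where C: "0 < C"
    "\<forall>\<^sub>F y in nhds x. norm (norm (\<phi> t y - \<phi> t x - D *v (y - x))) \<le> C * norm ((norm (y - x))\<^sup>2)"
    using assms unfolding fundamental_matrix_def by (elim landau_o.bigE) auto
  have "\<forall>\<^sub>F y in at x. norm (norm (\<phi> t y - \<phi> t x - D *v (y - x)) / norm (y - x)) \<le> C * norm (y - x)"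
    unfolding eventually_at_filter using C(2)
    by (rule eventually_mono) (auto simp: power2_eq_square divide_simps split: if_splits)
  moreover have "((\<lambda>y. C * norm (y - x)) \<longlongrightarrow> 0) (at x)"
    by (rule tendsto_eq_intros | simp)+
  ultimately have "((\<lambda>y. norm (\<phi> t y - \<phi> t x - D *v (y - x)) / norm (y - x)) \<longlongrightarrow> 0) (at x)"
    by (rule Lim_null_comparison)
  then show ?thesis
    unfolding has_derivative_iff_norm by (simp add: matrix_vector_mul_bounded_linear)
qed

text \<open>
  Divide the estimate at \<open>x + r k\<close> by \<open>r\<close> and let \<open>r\<close> tend to zero.
\<close>

lemma deviation_bound_imp_derivative_bound:
  fixes f1 f2 :: "'a::real_normed_vector \<Rightarrow> 'b::real_normed_vector"
  assumes f1: "(f1 has_derivative f1') (at x)" and f2: "(f2 has_derivative f2') (at x)"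
    and P: "bounded_linear P"
    and bound: "\<forall>\<^sub>F y in nhds x. norm ((f2 y - f2 x) - P (f1 y - f1 x)) \<le> \<kappa> * norm (f1 y - f1 x)"
  shows "norm (f2' k - P (f1' k)) \<le> \<kappa> * norm (f1' k)"
proof -
  interpret P: bounded_linear P by (rule P)
  have line: "((\<lambda>r. x + r *\<^sub>R k) has_derivative (\<lambda>r. r *\<^sub>R k)) (at 0)"
    by (auto intro!: derivative_eq_intros)
  have lim: "((\<lambda>r. (f (x + r *\<^sub>R k) - f x) /\<^sub>R r) \<longlongrightarrow> f' k) (at (0::real))"
    if f: "(f has_derivative f') (at x)" for f :: "'a \<Rightarrow> 'b" and f'
  proof -
    interpret f': bounded_linear f' using f by (rule has_derivative_bounded_linear)
    have "((\<lambda>r. f (x + r *\<^sub>R k)) has_derivative (\<lambda>r. f' (r *\<^sub>R k))) (at 0)"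
      using has_derivative_compose[OF line, of f f'] f by simp
    then have "((\<lambda>r. f (x + r *\<^sub>R k)) has_vector_derivative f' k) (at 0)"
      unfolding has_vector_derivative_def by (simp add: f'.scaleR)
    then have "((\<lambda>r. norm (f (x + r *\<^sub>R k) - f x - r *\<^sub>R f' k) / norm r) \<longlongrightarrow> 0) (at (0::real))"
      unfolding has_vector_derivative_def has_derivative_iff_norm by simp
    then have "((\<lambda>r. norm ((f (x + r *\<^sub>R k) - f x) /\<^sub>R r - f' k)) \<longlongrightarrow> 0) (at 0)"
    proof (rule Lim_transform_eventually)
      have "norm (f (x + r *\<^sub>R k) - f x - r *\<^sub>R f' k) / norm r
          = norm ((f (x + r *\<^sub>R k) - f x) /\<^sub>R r - f' k)" if "r \<noteq> 0" for r
      proof -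
        have "(f (x + r *\<^sub>R k) - f x) /\<^sub>R r - f' k = (f (x + r *\<^sub>R k) - f x - r *\<^sub>R f' k) /\<^sub>R r"
          using that by (simp add: scaleR_diff_right)
        then show ?thesis by (simp add: divide_inverse mult.commute)
      qed
      then show "\<forall>\<^sub>F r in at 0. norm (f (x + r *\<^sub>R k) - f x - r *\<^sub>R f' k) / norm r
          = norm ((f (x + r *\<^sub>R k) - f x) /\<^sub>R r - f' k)"
        unfolding eventually_at_filter by (intro always_eventually) auto
    qed
    then show ?thesis by (rule LIM_zero_cancel[OF tendsto_norm_zero_cancel])
  qed
  have "((\<lambda>r. x + r *\<^sub>R k) \<longlongrightarrow> x + 0 *\<^sub>R k) (at (0::real))" by (intro tendsto_intros)
  then have line_tendsto: "filterlim (\<lambda>r. x + r *\<^sub>R k) (nhds x) (at (0::real))" by simp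
  have "\<forall>\<^sub>F r in at (0::real). norm ((f2 (x + r *\<^sub>R k) - f2 x) - P (f1 (x + r *\<^sub>R k) - f1 x))
      \<le> \<kappa> * norm (f1 (x + r *\<^sub>R k) - f1 x)"
    by (rule eventually_compose_filterlim[OF bound line_tendsto])
  then have "\<forall>\<^sub>F r in at (0::real). norm ((f2 (x + r *\<^sub>R k) - f2 x) /\<^sub>R r - P ((f1 (x + r *\<^sub>R k) - f1 x) /\<^sub>R r))
      \<le> \<kappa> * norm ((f1 (x + r *\<^sub>R k) - f1 x) /\<^sub>R r)"
  proof (rule eventually_mono)
    fix r :: real
    assume b: "norm ((f2 (x + r *\<^sub>R k) - f2 x) - P (f1 (x + r *\<^sub>R k) - f1 x))
      \<le> \<kappa> * norm (f1 (x + r *\<^sub>R k) - f1 x)"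
    have "norm ((f2 (x + r *\<^sub>R k) - f2 x) /\<^sub>R r - P ((f1 (x + r *\<^sub>R k) - f1 x) /\<^sub>R r))
        = \<bar>inverse r\<bar> * norm ((f2 (x + r *\<^sub>R k) - f2 x) - P (f1 (x + r *\<^sub>R k) - f1 x))"
      unfolding P.scaleR scaleR_diff_right[symmetric] norm_scaleR ..
    also have "\<dots> \<le> \<bar>inverse r\<bar> * (\<kappa> * norm (f1 (x + r *\<^sub>R k) - f1 x))"
      using b by (intro mult_left_mono) auto
    finally show "norm ((f2 (x + r *\<^sub>R k) - f2 x) /\<^sub>R r - P ((f1 (x + r *\<^sub>R k) - f1 x) /\<^sub>R r))
      \<le> \<kappa> * norm ((f1 (x + r *\<^sub>R k) - f1 x) /\<^sub>R r)" by (simp add: mult_ac)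
  qed
  then show ?thesis
    by (rule tendsto_le[OF trivial_limit_at
          tendsto_mult[OF tendsto_const tendsto_norm[OF lim[OF f1]]]
          tendsto_norm[OF tendsto_diff[OF lim[OF f2] P.tendsto[OF lim[OF f1]]]]])
qed

lemma tendsto_matrixI:
  fixes D :: "'b \<Rightarrow> real ^ 'd ^ 'e"
  assumes "\<And>k. ((\<lambda>t. D t *v k) \<longlongrightarrow> l k) F"
  shows "(D \<longlongrightarrow> matrix l) F"
proof (intro vec_tendstoI)
  fix i j
  have "((\<lambda>t. (D t *v axis j 1) $ i) \<longlongrightarrow> l (axis j 1) $ i) F"
    using assms by (rule tendsto_vec_nth)
  then show "((\<lambda>t. D t $ i $ j) \<longlongrightarrow> matrix l $ i $ j) F"
    by (simp add: matrix_vector_mult_basis column_def matrix_def)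
qed

text \<open>
  The first estimate makes \<open>D\<close> Lipschitz, hence convergent, on the left of \<open>t1\<close>. In the second one lets
  \<open>s\<close> tend to \<open>t1\<close> first, for fixed \<open>t\<close>: then \<open>D t\<close> is close to \<open>S ** Dm\<close> for all \<open>t\<close> slightly larger than
  \<open>t1\<close>, so that the existence of the right-hand limit comes with its value.
\<close>

lemma saltation_limits:
  fixes D :: "real \<Rightarrow> real ^ 'd ^ 'd"
  assumes \<epsilon>: "0 < \<epsilon>" and L: "0 \<le> L" "L * \<epsilon> \<le> 1 / 2"
    and left: "\<And>s t k. t1 - \<epsilon> < s \<Longrightarrow> s \<le> t \<Longrightarrow> t < t1 \<Longrightarrow>
      norm (D t *v k - D s *v k) \<le> 2 * L * (t - s) * norm (D s *v k)"
    and across: "\<And>\<kappa>. 0 < \<kappa> \<Longrightarrow> \<exists>\<delta>>0. \<forall>s t k. t1 - \<delta> < s \<and> s < t1 \<and> t1 < t \<and> t < t1 + \<delta> \<longrightarrow>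
      norm (D t *v k - S *v (D s *v k)) \<le> \<kappa> * norm (D s *v k)"
  obtains Dm where "(D \<longlongrightarrow> Dm) (at_left t1)" "(D \<longlongrightarrow> S ** Dm) (at_right t1)"
proof -
  define s0 where "s0 = t1 - \<epsilon> / 2"
  have s0: "t1 - \<epsilon> < s0" "s0 < t1" using \<epsilon> unfolding s0_def by auto
  have "\<exists>l. ((\<lambda>t. D t *v k) \<longlongrightarrow> l) (at_left t1)" for k
  proof -
    let ?M = "2 * norm (D s0 *v k)"
    have M: "norm (D s *v k) \<le> ?M" if s: "s \<in> {s0<..<t1}" for s
    proof -
      have "L * (s - s0) \<le> L * (\<epsilon> / 2)" using s L(1) unfolding s0_def by (intro mult_left_mono) auto
      then have "2 * L * (s - s0) * norm (D s0 *v k) \<le> 1 * norm (D s0 *v k)"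
        using L(2) by (intro mult_right_mono) auto
      then have "norm (D s *v k - D s0 *v k) \<le> norm (D s0 *v k)"
        using left[of s0 s k] s s0 by simp
      then show ?thesis using norm_triangle_ineq2[of "D s *v k" "D s0 *v k"] by linarith
    qed
    have step: "dist (D t *v k) (D s *v k) \<le> (2 * L * ?M) * dist t s"
      if "s \<in> {s0<..<t1}" "t \<in> {s0<..<t1}" "s \<le> t" for s t
    proof -
      have "norm (D t *v k - D s *v k) \<le> 2 * L * (t - s) * norm (D s *v k)"
        using that s0 by (intro left) auto
      also have "\<dots> \<le> 2 * L * (t - s) * ?M"
        using that L(1) M by (intro mult_left_mono) auto
      finally have "norm (D t *v k - D s *v k) \<le> 2 * L * (t - s) * ?M" .
      moreover have "dist t s = t - s" using that by (simp add: dist_real_def)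
      ultimately show ?thesis unfolding dist_norm[of "D t *v k"] by (simp only: mult_ac)
    qed
    have "(2 * L * ?M)-lipschitz_on {s0<..<t1} (\<lambda>t. D t *v k)"
    proof (rule lipschitz_onI)
      fix s t assume "s \<in> {s0<..<t1}" "t \<in> {s0<..<t1}"
      then show "dist (D s *v k) (D t *v k) \<le> (2 * L * ?M) * dist s t"
        using step[of s t] step[of t s] by (cases "s \<le> t") (simp_all add: dist_commute)
    qed (use L in auto)
    then have "uniformly_continuous_on {s0<..<t1} (\<lambda>t. D t *v k)"
      by (rule lipschitz_on_uniformly_continuous)
    moreover have "t1 \<in> closure {s0<..<t1}" using s0 by simp
    ultimately obtain l where "((\<lambda>t. D t *v k) \<longlongrightarrow> l) (at t1 within {s0<..<t1})"
      by (rule uniformly_continuous_on_extension_at_closure)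
    moreover have "at t1 within {s0<..<t1} = at_left t1"
      by (rule at_within_nhd[of _ "{s0<..}"]) (use s0 in auto)
    ultimately show ?thesis by auto
  qed
  then obtain l where l: "\<And>k. ((\<lambda>t. D t *v k) \<longlongrightarrow> l k) (at_left t1)" by metis
  define Dm :: "real ^ 'd ^ 'd" where "Dm = matrix l"
  have Dm: "(D \<longlongrightarrow> Dm) (at_left t1)" unfolding Dm_def by (rule tendsto_matrixI[OF l])
  have Dm_k: "((\<lambda>s. D s *v k) \<longlongrightarrow> Dm *v k) (at_left t1)" for k
    unfolding matrix_vector_mult_def
    by (intro vec_tendstoI) (simp, intro tendsto_sum tendsto_mult tendsto_const tendsto_vec_nth Dm)
  have "((\<lambda>t. D t *v k) \<longlongrightarrow> (S ** Dm) *v k) (at_right t1)" for k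
  proof (rule tendstoI)
    fix e :: real assume e: "0 < e"
    define \<kappa> where "\<kappa> = e / (2 * (norm (Dm *v k) + 1))"
    have pos: "0 < norm (Dm *v k) + 1" by (simp add: add_nonneg_pos)
    have \<kappa>: "0 < \<kappa>" using e pos unfolding \<kappa>_def by auto
    obtain \<delta> where \<delta>: "0 < \<delta>" "\<And>s t k. t1 - \<delta> < s \<Longrightarrow> s < t1 \<Longrightarrow> t1 < t \<Longrightarrow> t < t1 + \<delta> \<Longrightarrow>
      norm (D t *v k - S *v (D s *v k)) \<le> \<kappa> * norm (D s *v k)"
      using across[OF \<kappa>] by blast
    have "dist (D t *v k) ((S ** Dm) *v k) < e" if t: "t1 < t" "t < t1 + \<delta>" for t
    proof -
      have "norm (D t *v k - S *v (Dm *v k)) \<le> \<kappa> * norm (Dm *v k)"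
      proof (rule tendsto_le)
        show "at_left t1 \<noteq> bot" by simp
        show "((\<lambda>s. \<kappa> * norm (D s *v k)) \<longlongrightarrow> \<kappa> * norm (Dm *v k)) (at_left t1)"
          by (intro tendsto_intros Dm_k)
        show "((\<lambda>s. norm (D t *v k - S *v (D s *v k))) \<longlongrightarrow> norm (D t *v k - S *v (Dm *v k))) (at_left t1)"
          by (intro tendsto_intros bounded_linear.tendsto[OF matrix_vector_mul_bounded_linear] Dm_k)
        show "\<forall>\<^sub>F s in at_left t1. norm (D t *v k - S *v (D s *v k)) \<le> \<kappa> * norm (D s *v k)"
          unfolding eventually_at_left_field using \<delta> t by (intro exI[of _ "t1 - \<delta>"]) auto
      qed
      also have "\<dots> \<le> e / 2" using e pos unfolding \<kappa>_def by (simp add: field_simps)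
      also have "\<dots> < e" using e by simp
      finally show ?thesis by (simp add: dist_norm matrix_vector_mul_assoc)
    qed
    then show "\<forall>\<^sub>F t in at_right t1. dist (D t *v k) ((S ** Dm) *v k) < e"
      unfolding eventually_at_right_field using \<delta>(1) by (intro exI[of _ "t1 + \<delta>"]) auto
  qed
  from tendsto_matrixI[OF this] have "(D \<longlongrightarrow> S ** Dm) (at_right t1)"
    by (simp add: matrix_of_matrix_vector_mul)
  with that Dm show thesis by blast
qed

lemma saltation_matrix_unique:
  fixes D :: "real \<Rightarrow> real ^ 'd ^ 'd"
  assumes "(D \<longlongrightarrow> Dm) (at_left t1)" "invertible Dm"
    and "saltation_matrix D t1 S" "saltation_matrix D t1 S'"
  shows "S' = S"
proof -
  obtain Dp Dm' where "(D \<longlongrightarrow> Dm') (at_left t1)" "(D \<longlongrightarrow> Dp) (at_right t1)" "Dp = S ** Dm'"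
    using assms(3) unfolding saltation_matrix_def by blast
  moreover obtain Dp' Dm'' where "(D \<longlongrightarrow> Dm'') (at_left t1)" "(D \<longlongrightarrow> Dp') (at_right t1)" "Dp' = S' ** Dm''"
    using assms(4) unfolding saltation_matrix_def by blast
  ultimately have eq: "S' ** Dm = S ** Dm"
    using assms(1) tendsto_unique[of "at_left t1" D] tendsto_unique[of "at_right t1" D]
    by (metis trivial_limit_at_left_real trivial_limit_at_right_real)
  obtain M where "Dm ** M = mat 1" using assms(2) unfolding invertible_def by blast
  then have "S' = S' ** (Dm ** M)" "S = S ** (Dm ** M)" by simp_all
  with eq show ?thesis by (metis matrix_mul_assoc)
qed

lemma C1_on_cmult:
  assumes "C1_on f N"
  shows "C1_on (\<lambda>p. c * f p) N"
proof -
  obtain f' where f': "\<And>p. p \<in> N \<Longrightarrow> (f has_derivative blinfun_apply (f' p)) (at p)" "continuous_on N f'"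
    using assms unfolding C1_on_def by blast
  have 1: "((\<lambda>p. c * f p) has_derivative blinfun_apply (c *\<^sub>R f' p)) (at p)" if "p \<in> N" for p
  proof -
    have "blinfun_apply (c *\<^sub>R f' p) = (\<lambda>k. c * blinfun_apply (f' p) k)"
      by (auto simp: blinfun.scaleR_left)
    then show ?thesis using has_derivative_mult_right[OF f'(1)[OF that], of c] by (simp only:)
  qed
  have 2: "continuous_on N (\<lambda>p. c *\<^sub>R f' p)" using f'(2) by (intro continuous_intros)
  show ?thesis unfolding C1_on_def by (rule exI[of _ "\<lambda>p. c *\<^sub>R f' p"]) (use 1 2 in auto)
qed

lemma rank_one_mult_vec:
  fixes a n x :: "real ^ 'd"
  shows "((columnvector a :: real ^ 1 ^ 'd) ** rowvector n) *v x = (n \<bullet> x) *\<^sub>R a"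
proof -
  have "((columnvector a :: real ^ 1 ^ 'd) ** rowvector n) $ i $ j = a $ i * n $ j" for i j
    by (simp add: matrix_matrix_mult_def columnvector_def rowvector_def)
  then have "(((columnvector a :: real ^ 1 ^ 'd) ** rowvector n) *v x) $ i = (\<Sum>j\<in>UNIV. a $ i * (n $ j * x $ j))" for i
    unfolding matrix_vector_mult_def by (simp add: mult.assoc)
  also have "(\<Sum>j\<in>UNIV. a $ i * (n $ j * x $ j)) = (n \<bullet> x) * a $ i" for i
    unfolding inner_vec_def sum_distrib_left[symmetric] by simp
  finally show ?thesis by (simp add: vec_eq_iff)
qed

text \<open>
  The hypotheses of the theorem give the partial derivatives of \<open>H\<close>; since \<open>H\<close> is differentiable in
  space-time, they determine its full derivative.
\<close>

lemma level_set_derivative: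
  fixes H :: "real \<Rightarrow> 'a::euclidean_space \<Rightarrow> real"
  assumes C1: "C1_on (\<lambda>(t, x). H t x) N" and p: "(t1, x1) \<in> N"
    and grad: "GDERIV (H t1) x1 :> g"
  shows "((\<lambda>(t, x). H t x) has_derivative (\<lambda>(r, x). deriv (\<lambda>t. H t x1) t1 * r + g \<bullet> x)) (at (t1, x1))"
proof -
  obtain F where F: "((\<lambda>(t, x). H t x) has_derivative F) (at (t1, x1))"
    using C1 p unfolding C1_on_def by blast
  interpret F: bounded_linear F using F by (rule has_derivative_bounded_linear)
  have "((\<lambda>t. (t, x1)) has_derivative (\<lambda>r. (r, 0))) (at t1)"
    by (intro has_derivative_Pair has_derivative_ident has_derivative_const)
  from has_derivative_compose[OF this F]
  have "((\<lambda>t. H t x1) has_derivative (\<lambda>r. F (r, 0))) (at t1)" by simp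
  moreover have "(\<lambda>r. F (r, 0)) = (*) (F (1, 0))"
  proof
    show "F (r, 0) = F (1, 0) * r" for r
      using F.scaleR[of r "(1, 0)"] by (simp add: mult.commute)
  qed
  ultimately have "((\<lambda>t. H t x1) has_field_derivative F (1, 0)) (at t1)"
    unfolding has_field_derivative_def by (simp only:)
  then have time: "deriv (\<lambda>t. H t x1) t1 = F (1, 0)" by (rule DERIV_imp_deriv)
  have "((\<lambda>x. (t1, x)) has_derivative (\<lambda>k. (0, k))) (at x1)"
    by (intro has_derivative_Pair has_derivative_ident has_derivative_const)
  from has_derivative_compose[OF this F]
  have "(H t1 has_derivative (\<lambda>k. F (0, k))) (at x1)" by simp
  then have "(\<lambda>k. F (0, k)) = (\<lambda>k. k \<bullet> g)"
    using grad unfolding gderiv_def by (rule has_derivative_unique)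
  then have space: "F (0, k) = g \<bullet> k" for k by (metis inner_commute)
  have F_eq: "F (r, k) = F (1, 0) * r + g \<bullet> k" for r k
  proof -
    have "F (r, k) = F (r *\<^sub>R (1, 0) + (0, k))" by simp
    also have "\<dots> = F (1, 0) * r + g \<bullet> k" unfolding F.add F.scaleR space by simp
    finally show ?thesis .
  qed
  have "F = (\<lambda>(r, x). deriv (\<lambda>t. H t x1) t1 * r + g \<bullet> x)"
  proof
    show "F p = (case p of (r, x) \<Rightarrow> deriv (\<lambda>t. H t x1) t1 * r + g \<bullet> x)" for p
    proof (cases p)
      case (Pair r k)
      show ?thesis unfolding Pair prod.case time by (rule F_eq)
    qed
  qed
  with F show ?thesis by simp
qed

text \<open>
  The neighbourhood \<open>\<delta>\<close> of the reference curve may depend on \<open>s\<close> and \<open>t\<close>: flow lines that start close enough to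
  \<open>x0\<close> are eventually in it, because the flow at these two times is differentiable, hence continuous.
\<close>

lemma curve_deviation_imp_fundamental_matrix_bound:
  fixes \<phi> :: "real \<Rightarrow> real ^ 'd \<Rightarrow> real ^ 'd"
  assumes flow: "\<forall>\<^sub>F x in nhds x0. trajectory v \<Omega> T x (\<lambda>t. \<phi> t x)"
    and st: "0 \<le> s" "s \<le> t" "t \<le> T"
    and fund: "fundamental_matrix \<phi> s x0 Ds" "fundamental_matrix \<phi> t x0 Dt"
    and P: "bounded_linear P"
    and dev: "\<exists>\<delta>>0. \<forall>w. integral_curve_on v {s..t} w \<and> norm (w s - \<phi> s x0) < \<delta> \<and> norm (w t - \<phi> t x0) < \<delta>
      \<longrightarrow> norm ((w t - \<phi> t x0) - P (w s - \<phi> s x0)) \<le> \<kappa> * norm (w s - \<phi> s x0)"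
  shows "norm (Dt *v k - P (Ds *v k)) \<le> \<kappa> * norm (Ds *v k)"
proof -
  note deriv = fundamental_matrix_imp_has_derivative[OF fund(1)]
    fundamental_matrix_imp_has_derivative[OF fund(2)]
  obtain \<delta> where \<delta>: "0 < \<delta>"
    "\<And>w. integral_curve_on v {s..t} w \<Longrightarrow> norm (w s - \<phi> s x0) < \<delta> \<Longrightarrow> norm (w t - \<phi> t x0) < \<delta>
      \<Longrightarrow> norm ((w t - \<phi> t x0) - P (w s - \<phi> s x0)) \<le> \<kappa> * norm (w s - \<phi> s x0)"
    using dev by blast
  have close: "\<forall>\<^sub>F y in nhds x0. norm (\<phi> r y - \<phi> r x0) < \<delta>"
    if "(\<phi> r has_derivative F) (at x0)" for r F
  proof -
    have "isCont (\<phi> r) x0" using that by (rule has_derivative_continuous)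
    then have "\<forall>\<^sub>F y in nhds x0. dist (\<phi> r y) (\<phi> r x0) < \<delta>"
      using \<delta>(1) by (intro tendstoD) (simp_all add: isCont_def tendsto_at_iff_tendsto_nhds)
    then show ?thesis by (simp add: dist_norm)
  qed
  have "\<forall>\<^sub>F y in nhds x0. norm ((\<phi> t y - \<phi> t x0) - P (\<phi> s y - \<phi> s x0)) \<le> \<kappa> * norm (\<phi> s y - \<phi> s x0)"
    using flow close[OF deriv(1)] close[OF deriv(2)]
  proof eventually_elim
    case (elim y)
    have "integral_curve_on v {s..t} (\<lambda>t. \<phi> t y)"
      by (rule integral_curve_on_subset[OF trajectory_imp_integral_curve_on[OF elim(1)]])
        (use st in auto)
    then show ?case using \<delta>(2)[of "\<lambda>t. \<phi> t y"] elim(2,3) by simp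
  qed
  then show ?thesis by (rule deviation_bound_imp_derivative_bound[OF deriv P])
qed

section \<open>The saltation matrix\<close>

theorem theorem4p4:
  fixes \<Omega> :: "(real ^ 'd) set"
    and v vm vp :: "real \<Rightarrow> real ^ 'd \<Rightarrow> real ^ 'd"
    and \<phi> :: "real \<Rightarrow> real ^ 'd \<Rightarrow> real ^ 'd"
    and H :: "real \<Rightarrow> real ^ 'd \<Rightarrow> real"
    and D :: "real \<Rightarrow> real ^ 'd ^ 'd"
    and N :: "(real \<times> (real ^ 'd)) set"
    and x0 x1 n :: "real ^ 'd"
    and T t1 \<sigma> :: real
  assumes dim: "CARD('d) \<in> {2, 3}"
    and dom: "open \<Omega>" "x0 \<in> \<Omega>" "0 < t1" "t1 < T"
    and flow: "\<forall>\<^sub>F x in nhds x0. trajectory v \<Omega> T x (\<lambda>t. \<phi> t x)"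
    and hit: "\<phi> t1 x0 = x1" "x1 \<in> switching_boundary \<Omega> H t1"
    and nbhd: "open N" "(t1, x1) \<in> N" "N \<subseteq> {0<..<T} \<times> \<Omega>"
    and H_C1: "C1_on (\<lambda>(t, x). H t x) N"
    and sign: "\<sigma> \<in> {-1, 1}"
    and field: "switching_field N \<sigma> H v vm vp"
    and normal: "unit_normal H t1 x1 n"
    and normalised: "deriv (\<lambda>t. H t x1) t1 \<noteq> 0 \<Longrightarrow> GDERIV (H t1) x1 :> n"
    and cross: "crosses_transversally \<sigma> H (\<lambda>t. \<phi> t x0) t1 n (vm t1 x1) (vp t1 x1)"
    and fund: "\<forall>\<^sub>F t in at t1. fundamental_matrix \<phi> t x0 (D t)"
  shows "let S = mat 1 +
           (1 / (n \<bullet> vm t1 x1 + deriv (\<lambda>t. H t x1) t1)) *\<^sub>R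
             ((columnvector (vp t1 x1 - vm t1 x1) :: real ^ 1 ^ 'd) ** rowvector n)
         in saltation_matrix D t1 S \<and>
            (\<forall>Dm S'. (D \<longlongrightarrow> Dm) (at_left t1) \<and> invertible Dm \<and> saltation_matrix D t1 S' \<longrightarrow> S' = S)"
proof -
  define Ht where "Ht = deriv (\<lambda>t. H t x1) t1"
  define h where "h = (\<lambda>t x. \<sigma> * H t x)"
  define u where "u = (\<lambda>t. \<phi> t x0)"
  define S where "S = mat 1 + (1 / (n \<bullet> vm t1 x1 + Ht)) *\<^sub>R
    ((columnvector (vp t1 x1 - vm t1 x1) :: real ^ 1 ^ 'd) ** rowvector n)"
  have \<sigma>: "\<sigma> \<noteq> 0" using sign by auto
  obtain c where n: "norm n = 1" and c: "c \<noteq> 0" "GDERIV (H t1) x1 :> c *\<^sub>R n"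
    using normal unfolding unit_normal_def by blast
  \<comment> \<open>The normal is normalised to be the gradient where the boundary moves; where it rests, \<open>Ht\<close> vanishes.\<close>
  have c_or: "c = 1 \<or> Ht = 0"
  proof (rule disjCI)
    assume "Ht \<noteq> 0"
    then have "(H t1 has_derivative (\<lambda>k. k \<bullet> n)) (at x1)"
      using normalised unfolding Ht_def gderiv_def by blast
    moreover have "(H t1 has_derivative (\<lambda>k. k \<bullet> (c *\<^sub>R n))) (at x1)"
      using c(2) unfolding gderiv_def .
    ultimately have "(\<lambda>k. k \<bullet> n) = (\<lambda>k. k \<bullet> (c *\<^sub>R n))" by (rule has_derivative_unique)
    then have "n \<bullet> n = n \<bullet> (c *\<^sub>R n)" by metis
    with n show "c = 1" by (simp add: dot_square_norm)
  qed
  define g where "g = (\<sigma> * c) *\<^sub>R n"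
  \<comment> \<open>Hence the rate in terms of the gradient is a nonzero multiple of the one in terms of the normal.\<close>
  have rate: "\<sigma> * Ht + g \<bullet> w = \<sigma> * c * (n \<bullet> w + Ht)" for w
    using c_or unfolding g_def by (auto simp: algebra_simps)
  have h_C1: "C1_on (\<lambda>(t, x). h t x) N"
    using C1_on_cmult[OF H_C1, of \<sigma>] unfolding h_def by (simp add: case_prod_unfold)
  have h_deriv: "((\<lambda>(t, x). h t x) has_derivative (\<lambda>(r, x). \<sigma> * Ht * r + g \<bullet> x)) (at (t1, x1))"
    using has_derivative_mult_right[OF level_set_derivative[OF H_C1 nbhd(2) c(2)], of \<sigma>]
    unfolding h_def g_def Ht_def by (simp add: case_prod_unfold algebra_simps)
  have h_sides: "h t x = 0 \<longleftrightarrow> H t x = 0" for t x using \<sigma> unfolding h_def by simp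
  have reg: "regular_field {(t, x) \<in> N. h t x \<le> 0} vm" "regular_field {(t, x) \<in> N. 0 \<le> h t x} vp"
    using field unfolding switching_field_def h_def by auto
  obtain Lm where Lm: "\<And>t. Lm-lipschitz_on {x. (t, x) \<in> N \<and> h t x \<le> 0} (vm t)"
    using reg(1) unfolding regular_field_def by auto
  obtain Lp where Lp: "\<And>t. Lp-lipschitz_on {x. (t, x) \<in> N \<and> 0 \<le> h t x} (vp t)"
    using reg(2) unfolding regular_field_def by auto
  define L where "L = max Lm Lp"
  have u: "integral_curve_on v {0..T} u"
    using trajectory_imp_integral_curve_on[OF eventually_nhds_x_imp_x[OF flow]] unfolding u_def .
  have transversal_rates: "n \<bullet> vm t1 x1 + Ht \<noteq> 0" "n \<bullet> vp t1 x1 + Ht \<noteq> 0"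
    using cross unfolding crosses_transversally_def Ht_def hit(1) by auto
  interpret transversal_crossing_curve N v vm vp h t1 "\<sigma> * Ht" L x1 g 0 T u
  proof
    show "open N" "(t1, x1) \<in> N" "0 < t1" "t1 < T" by (fact nbhd dom)+
    show "h t1 x1 = 0" using hit(2) unfolding switching_boundary_def h_def by simp
    show "C1_on (\<lambda>(t, x). h t x) N" by (fact h_C1)
    show "((\<lambda>(t, x). h t x) has_derivative (\<lambda>(r, x). \<sigma> * Ht * r + g \<bullet> x)) (at (t1, x1))"
      by (fact h_deriv)
    show "continuous_on {(t, x) \<in> N. h t x \<le> 0} (\<lambda>(t, x). vm t x)"
      "continuous_on {(t, x) \<in> N. 0 \<le> h t x} (\<lambda>(t, x). vp t x)"
      using reg unfolding regular_field_def by auto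
    show "L-lipschitz_on {x. (t, x) \<in> N \<and> h t x \<le> 0} (vm t)" for t
      using Lm[of t] by (rule lipschitz_on_le) (simp add: L_def)
    show "L-lipschitz_on {x. (t, x) \<in> N \<and> 0 \<le> h t x} (vp t)" for t
      using Lp[of t] by (rule lipschitz_on_le) (simp add: L_def)
    fix t x assume "(t, x) \<in> N"
    then show "h t x < 0 \<Longrightarrow> v t x = vm t x" "0 < h t x \<Longrightarrow> v t x = vp t x"
      "h t x = 0 \<Longrightarrow> v t x \<in> closed_segment (vm t x) (vp t x)"
      using field unfolding switching_field_def h_sides by (auto simp: h_def)
  next
    show "integral_curve_on v {0..T} u" "u t1 = x1" using u hit(1) by (auto simp: u_def)
    show "\<forall>\<^sub>F t in at_left t1. h t (u t) < 0" "\<forall>\<^sub>F t in at_right t1. 0 < h t (u t)"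
      using cross unfolding crosses_transversally_def h_def u_def by auto
    show "\<sigma> * Ht + g \<bullet> vm t1 x1 \<noteq> 0" "\<sigma> * Ht + g \<bullet> vp t1 x1 \<noteq> 0"
      unfolding rate using transversal_rates \<sigma> c(1) by auto
  qed
  have S: "S *v x = saltation_map (vm t1 x1) (vp t1 x1) g (\<sigma> * Ht) x" for x
  proof -
    have "(g \<bullet> x) / (\<sigma> * Ht + g \<bullet> vm t1 x1) = (n \<bullet> x) / (n \<bullet> vm t1 x1 + Ht)"
      unfolding rate unfolding g_def using \<sigma> c(1) by simp
    then show ?thesis
      unfolding S_def saltation_map_def
      by (simp add: matrix_vector_mult_add_rdistrib scaleR_matrix_vector_assoc[symmetric] rank_one_mult_vec)
  qed
  obtain \<epsilon>1 where \<epsilon>1: "0 < \<epsilon>1"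
    "\<And>t. t \<noteq> t1 \<Longrightarrow> \<bar>t - t1\<bar> < \<epsilon>1 \<Longrightarrow> fundamental_matrix \<phi> t x0 (D t)"
    using fund unfolding eventually_at by (auto simp: dist_real_def)
  \<comment> \<open>The minimum keeps the times considered inside the interval on which trajectories are defined.\<close>
  define \<epsilon>2 where "\<epsilon>2 = min \<epsilon>1 (min t1 (T - t1))"
  have \<epsilon>2: "0 < \<epsilon>2" "\<epsilon>2 \<le> \<epsilon>1" "\<epsilon>2 \<le> t1" "\<epsilon>2 \<le> T - t1" using \<epsilon>1(1) dom unfolding \<epsilon>2_def by auto
  obtain \<epsilon>3 where \<epsilon>3: "0 < \<epsilon>3"
    "\<And>s t. t1 - \<epsilon>3 < s \<Longrightarrow> s \<le> t \<Longrightarrow> t < t1 \<Longrightarrow>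
       \<exists>\<delta>>0. \<forall>w. integral_curve_on v {s..t} w \<and> norm (w s - u s) < \<delta> \<and> norm (w t - u t) < \<delta> \<longrightarrow>
         norm ((w t - u t) - (w s - u s)) \<le> 2 * L * (t - s) * norm (w s - u s)"
    "L * \<epsilon>3 \<le> 1 / 2"
    by (rule deviation_before_hitting) blast
  have left: "norm (D t *v k - D s *v k) \<le> 2 * L * (t - s) * norm (D s *v k)"
    if st: "t1 - min \<epsilon>2 \<epsilon>3 < s" "s \<le> t" "t < t1" for s t k
    using st \<epsilon>2 \<epsilon>1(2) \<epsilon>3(2)[of s t, unfolded u_def]
    by (intro curve_deviation_imp_fundamental_matrix_bound[OF flow, of s t _ _ "\<lambda>x. x"]) auto
  have across: "\<exists>\<delta>>0. \<forall>s t k. t1 - \<delta> < s \<and> s < t1 \<and> t1 < t \<and> t < t1 + \<delta> \<longrightarrow>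
      norm (D t *v k - S *v (D s *v k)) \<le> \<kappa> * norm (D s *v k)" if \<kappa>: "0 < \<kappa>" for \<kappa>
  proof -
    obtain \<epsilon>4 where \<epsilon>4: "0 < \<epsilon>4"
      "\<And>s t. t1 - \<epsilon>4 < s \<Longrightarrow> s < t1 \<Longrightarrow> t1 < t \<Longrightarrow> t < t1 + \<epsilon>4 \<Longrightarrow>
       \<exists>\<delta>>0. \<forall>w. integral_curve_on v {s..t} w \<and> norm (w s - u s) < \<delta> \<and> norm (w t - u t) < \<delta> \<longrightarrow>
         norm ((w t - u t) - S *v (w s - u s)) \<le> \<kappa> * norm (w s - u s)"
      using deviation_across_hitting[OF \<kappa>] unfolding S by blast
    have "norm (D t *v k - S *v (D s *v k)) \<le> \<kappa> * norm (D s *v k)"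
      if st: "t1 - min \<epsilon>2 \<epsilon>4 < s" "s < t1" "t1 < t" "t < t1 + min \<epsilon>2 \<epsilon>4" for s t k
      using st \<epsilon>2 \<epsilon>1(2) \<epsilon>4(2)[of s t, unfolded u_def]
      by (intro curve_deviation_imp_fundamental_matrix_bound[OF flow, of s t _ _ "(*v) S"]) auto
    then show ?thesis using \<epsilon>2(1) \<epsilon>4(1) by (intro exI[of _ "min \<epsilon>2 \<epsilon>4"]) auto
  qed
  have "L * min \<epsilon>2 \<epsilon>3 \<le> L * \<epsilon>3" using L_nonneg by (intro mult_left_mono) auto
  then have "L * min \<epsilon>2 \<epsilon>3 \<le> 1 / 2" using \<epsilon>3(3) by linarith
  moreover have "0 < min \<epsilon>2 \<epsilon>3" using \<epsilon>2(1) \<epsilon>3(1) by simp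
  ultimately obtain Dm where "(D \<longlongrightarrow> Dm) (at_left t1)" "(D \<longlongrightarrow> S ** Dm) (at_right t1)"
    using saltation_limits[OF _ L_nonneg _ left across] by blast
  then have "saltation_matrix D t1 S" unfolding saltation_matrix_def by blast
  with saltation_matrix_unique show ?thesis
    unfolding Let_def Ht_def[symmetric] S_def[symmetric] by blast
qed

end
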